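(* (Affine Decomposition Lemma) For every $v\in\widetilde S_n$, $$\lvert\widetilde{\mathtt s}^{-1}(v)\rvert=\sum_{\mathscr M\in\mathrm{Sky}(v)}\ \prod_{i=1}^{r(\mathscr M)}\left\lvert\mathtt s^{-1}\!\left(z_i^{\mathscr M}\right)\right\rvert .$$
   Context: West's stack-sorting map $\mathtt s$ acts on permutations of finite sets of integers (written as words with distinct letters): $\mathtt s(\varepsilon)=\varepsilon$ for the empty word, and if $m$ is the largest entry of $w=\mathsf L\,m\,\mathsf R$, then $\mathtt s(w)=\mathtt s(\mathsf L)\,\mathtt s(\mathsf R)\,m$. An affine permutation of size $n$ is a bijection $w:\mathbb Z\to\mathbb Z$ with $w(i+n)=w(i)+n$ for all $i\in\mathbb Z$ and $\sum_{i=1}^n w(i)=\binom{n+1}{2}$. They form the affine symmetric group $\widetilde S_n$ under composition (trivial if $n=1$), a Coxeter group with simple generators $\widetilde s_1,\ldots,\widetilde s_n$, where $\widetilde s_i$ swaps $i+mn$ and $i+mn+1$ for all $m\in\mathbb Z$ and fixes all other integers. The left weak order is $x\leq_L y\iff\ell(yx^{-1})=\ell(y)-\ell(x)$, $\ell$ being Coxeter length. Affine sylvester congruence. For $w\in\widetilde S_n$ define a partial order $\preceq_w$ on $\mathbb Z$ (positions): for $i<j$, the positions $i,j$ are incomparable if and only if there is $k$ with $i<k<j$ and $w(k)>\max\{w(i),w(j)\}$; otherwise the position with the smaller value of $w$ is below the other. (This is the descendant order of the decreasing affine binary plane tree with in-order reading $w$.) The affine sylvester congruence is $v\equiv_{\widetilde{\mathrm{syl}}}w\iff{\preceq_v}={\preceq_w}$;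 it is a semilattice congruence on $(\widetilde S_n,\leq_L)$ in which $\{e\}$ is a class, and each class has a unique $\leq_L$-minimal element. Let $\pi_\downarrow(w)$ be the minimal element of the class of $w$. The affine stack-sorting map is $\widetilde{\mathtt s}:\widetilde S_n\to\widetilde S_n$, $\widetilde{\mathtt s}(w)=w\,(\pi_\downarrow(w))^{-1}$. Let $v\in\widetilde S_n$. A left-to-right maximum of $v$ is an integer $m$ larger than every integer appearing to its left in the word $\cdots v(0)v(1)v(2)\cdots$. A set $Y\subseteq\mathbb Z$ is $n$-periodic if $j\in Y\iff j+n\in Y$. $\mathrm{Sky}(v)$ is the collection of all nonempty $n$-periodic subsets of the set of left-to-right maxima of $v$. For $\mathscr M\in\mathrm{Sky}(v)$ write $\mathscr M=\{\cdots<m_0<m_1<m_2<\cdots\}$ with indices chosen so that $v^{-1}(m_1)\le 1<v^{-1}(m_2)$; $r(\mathscr M)$ is the positive integer with $m_{j+r(\mathscr M)}=m_j+n$ for all $j$; and $z_i^{\mathscr M}$ is the (finite, possibly empty) permutation whose word consists of the entries of $v$ strictly between $m_i$ and $m_{i+1}$. *)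

theory Defs
  imports Complex_Main
begin

function stack_sort :: "int list \<Rightarrow> int list" where
  "stack_sort w =
    (if w = [] then []
     else let m = Max (set w)
          in stack_sort (takeWhile (\<lambda>x. x \<noteq> m) w)
             @ stack_sort (tl (dropWhile (\<lambda>x. x \<noteq> m) w)) @ [m])"
  by pat_completeness auto
termination
proof (relation "measure length")
  fix w :: "int list" and m
  assume ne: "w \<noteq> []" and m: "m = Max (set w)"
  then have "m \<in> set w" by simp
  then have "dropWhile (\<lambda>x. x \<noteq> m) w \<noteq> []"
    by (simp add: dropWhile_eq_Nil_conv)
  moreover have "length (takeWhile (\<lambda>x. x \<noteq> m) w) + length (dropWhile (\<lambda>x. x \<noteq> m) w) = length w"
    by (metis length_append takeWhile_dropWhile_id)
  ultimately have "length (takeWhile (\<lambda>x. x \<noteq> m) w) < length w"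
    by (cases "dropWhile (\<lambda>x. x \<noteq> m) w") auto
  then show "(takeWhile (\<lambda>x. x \<noteq> m) w, w) \<in> measure length" by simp
next
  fix w :: "int list" and m
  assume ne: "w \<noteq> []"
  have "length (dropWhile (\<lambda>x. x \<noteq> m) w) \<le> length w"
    by (rule length_dropWhile_le)
  moreover have "0 < length w" using ne by simp
  ultimately have "length (tl (dropWhile (\<lambda>x. x \<noteq> m) w)) < length w"
    unfolding length_tl by linarith
  then show "(tl (dropWhile (\<lambda>x. x \<noteq> m) w), w) \<in> measure length" by simp
qed simp

declare stack_sort.simps [simp del]

text \<open>The defining recursion \<open>s(L m R) = s(L) s(R) m\<close>.\<close>

lemma stack_sort_Nil: "stack_sort [] = []"
  by (subst stack_sort.simps) simp

lemma stack_sort_decomp: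
  assumes "\<And>x. x \<in> set L \<union> set R \<Longrightarrow> x < m"
  shows "stack_sort (L @ m # R) = stack_sort L @ stack_sort R @ [m]"
proof -
  have "Max (set (L @ m # R)) = m"
    using assms by (intro Max_eqI) (auto intro: less_imp_le)
  moreover have "takeWhile (\<lambda>x. x \<noteq> m) (L @ m # R) = L"
    using assms by (subst takeWhile_append2) fastforce+
  moreover have "dropWhile (\<lambda>x. x \<noteq> m) (L @ m # R) = m # R"
    using assms by (subst dropWhile_append2) fastforce+
  ultimately show ?thesis
    by (subst stack_sort.simps) (simp add: Let_def)
qed

definition stack_sort_preimage :: "int list \<Rightarrow> int list set" where
  "stack_sort_preimage z = {u. distinct u \<and> stack_sort u = z}"

definition affine_perms :: "nat \<Rightarrow> (int \<Rightarrow> int) set" where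
  "affine_perms n =
    {w. bij w \<and> (\<forall>i. w (i + int n) = w i + int n)
        \<and> (\<Sum>i=1..int n. w i) = int ((n + 1) choose 2)}"

definition affine_simple :: "nat \<Rightarrow> int \<Rightarrow> int \<Rightarrow> int" where
  "affine_simple n i x =
    (if int n dvd x - i then x + 1
     else if int n dvd x - (i + 1) then x - 1
     else x)"

text \<open>For \<open>n = 1\<close> the group is trivial and has no generators (there
  \<open>affine_simple\<close> would be a translation rather than a transposition).\<close>

definition affine_generators :: "nat \<Rightarrow> (int \<Rightarrow> int) set" where
  "affine_generators n = (if n \<le> 1 then {} else affine_simple n ` {1..int n})"

definition coxeter_length :: "nat \<Rightarrow> (int \<Rightarrow> int) \<Rightarrow> nat" where
  "coxeter_length n w =
    (LEAST k. \<exists>gs. length gs = k \<and> set gs \<subseteq> affine_generators n \<and> w = foldr (\<circ>) gs id)"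

definition left_weak_le :: "nat \<Rightarrow> (int \<Rightarrow> int) \<Rightarrow> (int \<Rightarrow> int) \<Rightarrow> bool" where
  "left_weak_le n x y \<longleftrightarrow>
    int (coxeter_length n (y \<circ> inv x)) = int (coxeter_length n y) - int (coxeter_length n x)"

definition incomparable_pos :: "(int \<Rightarrow> int) \<Rightarrow> int \<Rightarrow> int \<Rightarrow> bool" where
  "incomparable_pos w i j \<longleftrightarrow>
    (\<exists>k. min i j < k \<and> k < max i j \<and> w k > max (w i) (w j))"

definition desc_le :: "(int \<Rightarrow> int) \<Rightarrow> int \<Rightarrow> int \<Rightarrow> bool" where
  "desc_le w i j \<longleftrightarrow> i = j \<or> (\<not> incomparable_pos w i j \<and> w i < w j)"

definition syl_class :: "nat \<Rightarrow> (int \<Rightarrow> int) \<Rightarrow> (int \<Rightarrow> int) set" where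
  "syl_class n w = {u \<in> affine_perms n. desc_le u = desc_le w}"

definition pi_down :: "nat \<Rightarrow> (int \<Rightarrow> int) \<Rightarrow> (int \<Rightarrow> int)" where
  "pi_down n w =
    (THE u. u \<in> syl_class n w \<and> (\<forall>x \<in> syl_class n w. left_weak_le n x u \<longrightarrow> x = u))"

definition affine_stack_sort :: "nat \<Rightarrow> (int \<Rightarrow> int) \<Rightarrow> (int \<Rightarrow> int)" where
  "affine_stack_sort n w = w \<circ> inv (pi_down n w)"

definition affine_stack_sort_preimage :: "nat \<Rightarrow> (int \<Rightarrow> int) \<Rightarrow> (int \<Rightarrow> int) set" where
  "affine_stack_sort_preimage n v = {w \<in> affine_perms n. affine_stack_sort n w = v}"

text \<open>Left-to-right maxima, and hence the members of a skyline, are \<^emph>\<open>values\<close> of \<open>v\<close>;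
  \<open>inv v\<close> gives their positions.\<close>

definition ltr_maxima :: "(int \<Rightarrow> int) \<Rightarrow> int set" where
  "ltr_maxima v = {m. \<forall>j < inv v m. v j < m}"

definition periodic_set :: "nat \<Rightarrow> int set \<Rightarrow> bool" where
  "periodic_set n Y \<longleftrightarrow> (\<forall>j. j \<in> Y \<longleftrightarrow> j + int n \<in> Y)"

definition Sky :: "nat \<Rightarrow> (int \<Rightarrow> int) \<Rightarrow> int set set" where
  "Sky n v = {M. M \<noteq> {} \<and> periodic_set n M \<and> M \<subseteq> ltr_maxima v}"

definition sky_enum :: "(int \<Rightarrow> int) \<Rightarrow> int set \<Rightarrow> int \<Rightarrow> int" where
  "sky_enum v M =
    (THE m. strict_mono m \<and> range m = M \<and> inv v (m 1) \<le> 1 \<and> 1 < inv v (m 2))"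

definition sky_period :: "nat \<Rightarrow> (int \<Rightarrow> int) \<Rightarrow> int set \<Rightarrow> int" where
  "sky_period n v M =
    (THE r. 0 < r \<and> (\<forall>j. sky_enum v M (j + r) = sky_enum v M j + int n))"

text \<open>``Between'' refers to positions in the word of \<open>v\<close>, not to values.\<close>

definition sky_word :: "(int \<Rightarrow> int) \<Rightarrow> int set \<Rightarrow> int \<Rightarrow> int list" where
  "sky_word v M i =
    map v [inv v (sky_enum v M i) + 1 .. inv v (sky_enum v M (i + 1)) - 1]"

end

theory Submission
  imports Defs "HOL-Library.FuncSet"
begin

text \<open>Coxeter length is the number of inversions modulo translation, so containment of
  inversion sets implies the left weak order. Hence the minimal element of the sylvester class
  of \<open>w\<close> is the affine permutation whose inversions \<open>i < j\<close> are exactly those where \<open>j\<close> is a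
  descendant of \<open>i\<close>: the postorder labelling. Cut the positions into blocks, each starting at a
  left-to-right maximum of \<open>w\<close>. Within a block the word \<open>m R\<close> has its maximum first, no such
  pair \<open>i < j\<close> crosses a block boundary, and so reading \<open>w\<close> in postorder replaces every block by
  its stack-sorted word \<open>s(R) m\<close>. A preimage of \<open>v\<close> therefore amounts to a choice of periodic block
  ends among the left-to-right maxima of \<open>v\<close> (a skyline) together with, for one period of blocks,
  a preimage of the word of \<open>v\<close> between consecutive ends.\<close>

section \<open>Affine permutations\<close>

text \<open>The obstacle is that postorder on the integers gives no direct labelling: ranks are
  infinite, and the labels would have to be bijective and meet the sum condition. So the labelling
  is not built directly. The sorted blocks are glued into \<open>v\<close>; rearranging values
  inside blocks keeps an affine permutation affine, and \<open>inv v \<circ> w\<close> is then the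
  labelling. Only its inversions remain to be checked, a finite question inside one block. The same
  gluing, with each block \<open>s(R) m\<close> of \<open>v\<close> replaced by \<open>m R\<close>,
  produces the preimages.

  Inversions are recorded as pairs of positions because left multiplication by a generator swaps
  values: it adds or removes one translation orbit of such pairs.

  A skyline consists of values of \<open>v\<close> at block ends, while blocks are indexed by their
  starting positions, one place after the previous end. This is the source of the offsets 1 and
  2.\<close>

lemma affine_permsD:
  assumes "w \<in> affine_perms n"
  shows "bij w" "w (i + int n) = w i + int n"
  using assms by (auto simp: affine_perms_def)

lemma quasi_periodic_mult:
  fixes w :: "int \<Rightarrow> int"
  assumes "\<And>i. w (i + N) = w i + N"
  shows "w (i + N * k) = w i + N * k"
proof (induction k rule: int_induct[where k = 0])
  case (step1 k)
  have "w (i + N * (k + 1)) = w (i + N * k + N)" by (simp add: algebra_simps)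
  also have "\<dots> = w i + N * k + N" by (simp only: assms step1.IH)
  finally show ?case by (simp add: algebra_simps)
next
  case (step2 k)
  have "w (i + N * k) = w (i + N * (k - 1) + N)" by (simp add: algebra_simps)
  also have "\<dots> = w (i + N * (k - 1)) + N" by (simp only: assms)
  finally show ?case using step2.IH by (simp add: algebra_simps)
qed simp

lemma affine_perms_shift:
  "w \<in> affine_perms n \<Longrightarrow> w (i + int n * k) = w i + int n * k"
  by (rule quasi_periodic_mult) (rule affine_permsD)

lemma map_upto_shift:
  assumes "w \<in> affine_perms n"
  shows "map w [x + int n * k..y + int n * k] = map (\<lambda>i. i + int n * k) (map w [x..y])"
proof (rule nth_equalityI)
  fix t
  assume "t < length (map w [x + int n * k..y + int n * k])"
  moreover have "w (x + int n * k + int t) = w (x + int t) + int n * k"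
    using affine_perms_shift[OF assms, of "x + int t" k] by (simp add: algebra_simps)
  ultimately show "map w [x + int n * k..y + int n * k] ! t =
      map (\<lambda>i. i + int n * k) (map w [x..y]) ! t"
    by simp
qed simp

lemma affine_perms_eq_iff:
  "w \<in> affine_perms n \<Longrightarrow> w i = w j \<longleftrightarrow> i = j"
  by (meson affine_permsD(1) bij_is_inj inj_eq)

text \<open>\<open>n\<close> indices with distinct residues form a complete residue system. The
  general index map \<open>x\<close> covers a translated window as well as a window moved by an
  affine permutation.\<close>

lemma sum_periodic_reindex:
  fixes g :: "int \<Rightarrow> int"
  assumes "n \<ge> 1" and g: "\<And>i. g (i + int n) = g i"
    and "finite I" "card I = n" "inj_on (\<lambda>i. x i mod int n) I"
  shows "(\<Sum>i\<in>I. g (x i)) = (\<Sum>i\<in>{0..<int n}. g i)"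
proof -
  have "g (i + int n * k) = g i" for i k
    using quasi_periodic_mult[of "\<lambda>i. g i + i" "int n" i k] g by simp
  then have gm: "g (j mod int n) = g j" for j
    by (metis mod_mult_div_eq)
  have sub: "(\<lambda>i. x i mod int n) ` I \<subseteq> {0..<int n}"
    using \<open>n \<ge> 1\<close> by auto
  have "card ((\<lambda>i. x i mod int n) ` I) = card {0..<int n}"
    using assms card_image by fastforce
  then have "(\<lambda>i. x i mod int n) ` I = {0..<int n}"
    using sub by (intro card_subset_eq) auto
  then have "bij_betw (\<lambda>i. x i mod int n) I {0..<int n}"
    using assms by (simp add: bij_betw_def)
  from sum.reindex_bij_betw[OF this, of g] show ?thesis by (simp add: gm)
qed

lemma inj_on_mod_interval: "inj_on (\<lambda>i. i mod int n) {c..<c + int n}"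
proof (rule inj_onI)
  fix i j assume ij: "i \<in> {c..<c + int n}" "j \<in> {c..<c + int n}" "i mod int n = j mod int n"
  then have "int n dvd i - j" by (simp add: mod_eq_dvd_iff)
  moreover have "\<bar>i - j\<bar> < int n" using ij by auto
  ultimately show "i = j" using zdvd_imp_le[of "int n" "\<bar>i - j\<bar>"] by (cases "i = j") auto
qed

lemma sum_periodic_window:
  fixes g :: "int \<Rightarrow> int"
  assumes "n \<ge> 1" and g: "\<And>i. g (i + int n) = g i"
  shows "(\<Sum>i\<in>{c..<c + int n}. g i) = (\<Sum>i\<in>{0..<int n}. g i)"
  using assms inj_on_mod_interval
  by (intro sum_periodic_reindex[where I = "{c..<c + int n}" and x = "\<lambda>i. i"]) auto

lemma int_choose_two: "int ((n + 1) choose 2) = (\<Sum>i=1..int n. i)"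
proof (induction n)
  case (Suc n)
  have "{1..int (Suc n)} = insert (int n + 1) {1..int n}" by auto
  then show ?case using Suc by (simp add: numeral_2_eq_2)
qed (simp add: binomial_eq_0)

text \<open>The displacement \<open>w i - i\<close> is \<open>n\<close>-periodic, so its sum is the
  same over every window of length \<open>n\<close>. With \<open>c\<close> free, each use can pick
  the window that suits it.\<close>

lemma affine_perms_iff_displacement:
  assumes "n \<ge> 1"
  shows "w \<in> affine_perms n \<longleftrightarrow>
    bij w \<and> (\<forall>i. w (i + int n) = w i + int n) \<and> (\<Sum>i\<in>{c..<c + int n}. w i - i) = 0"
proof -
  have "(\<Sum>i\<in>{c..<c + int n}. w i - i) = (\<Sum>i=1..int n. w i) - int ((n + 1) choose 2)"
    if "\<And>i. w (i + int n) = w i + int n"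
  proof -
    have "(\<Sum>i\<in>{c..<c + int n}. w i - i) = (\<Sum>i\<in>{1..<1 + int n}. w i - i)"
      by (rule trans[OF sum_periodic_window sum_periodic_window[symmetric]])
        (use assms in \<open>simp_all add: that\<close>)
    also have "{1..<1 + int n} = {1..int n}" by auto
    finally show ?thesis by (simp only: sum_subtractf int_choose_two)
  qed
  then show ?thesis by (auto simp: affine_perms_def)
qed

lemma inj_on_mod_affine_perm:
  assumes "w \<in> affine_perms n"
  shows "inj_on (\<lambda>i. w i mod int n) {c..<c + int n}"
proof (rule inj_onI)
  fix i j assume ij: "i \<in> {c..<c + int n}" "j \<in> {c..<c + int n}" "w i mod int n = w j mod int n"
  then have "int n dvd w i - w j" by (simp add: mod_eq_dvd_iff)
  then obtain k where "w i = w j + int n * k" by (metis dvdE add.commute diff_add_cancel)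
  then have "w i = w (j + int n * k)" by (simp add: affine_perms_shift[OF assms])
  then have "i = j + int n * k" using affine_perms_eq_iff[OF assms] by blast
  then have "i mod int n = j mod int n" by simp
  then show "i = j" using ij inj_on_mod_interval[of n c] by (auto dest: inj_onD)
qed

lemma sum_periodic_comp:
  assumes n: "n \<ge> 1" and x: "x \<in> affine_perms n" and g: "\<And>i. g (i + int n) = g i"
  shows "(\<Sum>i\<in>{c..<c + int n}. g (x i)) = (\<Sum>i\<in>{c..<c + int n}. (g i :: int))"
proof -
  have "(\<Sum>i\<in>{c..<c + int n}. g (x i)) = (\<Sum>i\<in>{0..<int n}. g i)"
    using inj_on_mod_affine_perm[OF x] by (intro sum_periodic_reindex n g) auto
  also have "\<dots> = (\<Sum>i\<in>{c..<c + int n}. g i)"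
    by (rule sum_periodic_window[symmetric]) (fact n, fact g)
  finally show ?thesis .
qed

lemma affine_perms_comp:
  assumes n: "n \<ge> 1" and y: "y \<in> affine_perms n" and x: "x \<in> affine_perms n"
  shows "y \<circ> x \<in> affine_perms n"
proof -
  \<comment> \<open>The displacement of \<open>y \<circ> x\<close> at \<open>i\<close> is that of
    \<open>y\<close> at \<open>x i\<close> plus that of \<open>x\<close> at \<open>i\<close>; since
    \<open>x\<close> permutes residues, the first part has the same sum as the displacement of
    \<open>y\<close>.\<close>
  have "(\<Sum>i\<in>{0..<0 + int n}. y (x i) - x i) = (\<Sum>i\<in>{0..<0 + int n}. y i - i)"
    using affine_permsD(2)[OF y] by (intro sum_periodic_comp[OF n x]) simp
  then have "(\<Sum>i\<in>{0..<0 + int n}. y (x i) - i) = 0"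
    using y x by (simp add: affine_perms_iff_displacement[OF n, of _ 0] sum_subtractf)
  then show ?thesis
    using affine_permsD[OF y] affine_permsD[OF x]
    by (simp add: affine_perms_iff_displacement[OF n, of _ 0] bij_comp)
qed

lemma affine_perms_inv:
  assumes n: "n \<ge> 1" and x: "x \<in> affine_perms n"
  shows "inv x \<in> affine_perms n"
proof -
  note b = affine_permsD(1)[OF x]
  have per: "inv x (i + int n) = inv x i + int n" for i
  proof (rule inv_f_eq[OF bij_is_inj[OF b]])
    show "x (inv x i + int n) = i + int n"
      using b by (simp add: affine_permsD(2)[OF x] bij_is_surj surj_f_inv_f)
  qed
  have "(\<Sum>i\<in>{0..<0 + int n}. inv x (x i) - x i) = (\<Sum>i\<in>{0..<0 + int n}. inv x i - i)"
    using per by (intro sum_periodic_comp[OF n x]) simp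
  then have "(\<Sum>i\<in>{0..<0 + int n}. inv x i - i) = 0"
    using x b by (simp add: affine_perms_iff_displacement[OF n, of _ 0] sum_subtractf bij_is_inj)
  then show ?thesis
    using b per by (simp add: affine_perms_iff_displacement[OF n, of _ 0] bij_imp_bij_inv)
qed

lemma affine_perms_inv_apply:
  assumes "w \<in> affine_perms n"
  shows "w (inv w i) = i" "inv w (w i) = i"
  using affine_permsD(1)[OF assms] by (simp_all add: bij_is_inj bij_is_surj surj_f_inv_f)

lemma id_affine_perms: "id \<in> affine_perms n"
  using int_choose_two[of n] by (simp add: affine_perms_def)

text \<open>Displacement depends only on the residue of the position, so it takes finitely many
  values. The bound makes inversions finite modulo translation and guarantees that left-to-right
  maxima exist.\<close>

lemma affine_perms_displacement_bounded:
  assumes n: "n \<ge> 1" and w: "w \<in> affine_perms n"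
  obtains B where "\<And>i. \<bar>w i - i\<bar> \<le> B"
proof
  fix i
  have "w i - i = w (i mod int n) - i mod int n"
    using affine_perms_shift[OF w, of "i mod int n" "i div int n"] by (simp add: algebra_simps)
  moreover have "i mod int n \<in> {0..<int n}" using n by simp
  ultimately show "\<bar>w i - i\<bar> \<le> Max ((\<lambda>i. \<bar>w i - i\<bar>) ` {0..<int n})"
    by (metis (no_types, lifting) Max_ge finite_atLeastLessThan_int finite_imageI imageI)
qed

section \<open>Increasing maps on the integers\<close>

lemma strict_mono_int_if_step:
  fixes f :: "int \<Rightarrow> 'a :: order"
  assumes step: "\<And>k. f k < f (k + 1)"
  shows "strict_mono f"
proof (rule strict_monoI)
  fix x y :: int assume "x < y"
  then show "f x < f y"
    by (induction y rule: int_gr_induct) (use step less_trans in blast)+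
qed

lemma strict_mono_bij_int_translation:
  fixes f :: "int \<Rightarrow> int"
  assumes step: "\<And>k. f k < f (k + 1)" and "surj f"
  shows "f k = k + f 0"
proof -
  have mono: "strict_mono f" using step by (rule strict_mono_int_if_step)
  have succ: "f (k + 1) = f k + 1" for k
  proof -
    obtain j where j: "f j = f k + 1" using \<open>surj f\<close> by (metis surjD)
    then have "k < j" using strict_mono_less[OF mono, of k j] by simp
    moreover have "j \<le> k + 1"
      using strict_mono_less_eq[OF mono, of j "k + 1"] j step[of k] by simp
    ultimately show ?thesis using j by (metis add1_zle_eq order_antisym)
  qed
  then show ?thesis using quasi_periodic_mult[of f 1 0 k] by simp
qed

text \<open>An increasing bijection is a translation, and the zero displacement sum excludes every
  translation but the identity.\<close>

lemma affine_perm_increasing_eq_id: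
  assumes n: "n \<ge> 1" and w: "w \<in> affine_perms n" and step: "\<And>k. w k < w (k + 1)"
  shows "w = id"
proof -
  have tr: "w k = k + w 0" for k
    using strict_mono_bij_int_translation[of w] step affine_permsD(1)[OF w] bij_is_surj by blast
  have "(\<Sum>i\<in>{0..<0 + int n}. w i - i) = int n * w 0"
    by (subst tr) simp
  then have "w 0 = 0" using w n by (simp add: affine_perms_iff_displacement[OF n, of _ 0])
  then show ?thesis by (intro ext) (metis tr add.right_neutral id_apply)
qed

section \<open>Coxeter length and the left weak order\<close>

definition inversions :: "(int \<Rightarrow> int) \<Rightarrow> (int \<times> int) set" where
  "inversions w = {(i, j). i < j \<and> w j < w i}"

text \<open>Translating both positions by \<open>n\<close> preserves inversions; each orbit has
  exactly one pair whose first entry lies in \<open>{1..int n}\<close>.\<close>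

definition inversion_number :: "nat \<Rightarrow> (int \<Rightarrow> int) \<Rightarrow> nat" where
  "inversion_number n w = card (inversions w \<inter> {1..int n} \<times> UNIV)"

lemma finite_inversion_window:
  assumes "n \<ge> 1" "w \<in> affine_perms n"
  shows "finite (inversions w \<inter> {1..int n} \<times> UNIV)"
proof -
  obtain B where B: "\<And>i. \<bar>w i - i\<bar> \<le> B" using affine_perms_displacement_bounded assms by blast
  have "inversions w \<inter> {1..int n} \<times> UNIV \<subseteq> {1..int n} \<times> {1..int n + 2 * B}"
  proof clarsimp
    fix i j assume "(i, j) \<in> inversions w" "1 \<le> i" "i \<le> int n"
    then show "1 \<le> j \<and> j \<le> int n + 2 * B" using B[of i] B[of j] by (auto simp: inversions_def)
  qed
  then show ?thesis by (rule finite_subset) simp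
qed

section \<open>Left multiplication by simple generators\<close>

lemma not_dvd_consecutive:
  assumes "n \<ge> 2" shows "\<not> (int n dvd c \<and> int n dvd c + 1)"
proof
  assume "int n dvd c \<and> int n dvd c + 1"
  then have "int n dvd 1" using dvd_add_right_iff by blast
  then show False using assms by simp
qed

lemma affine_simple_offset:
  "affine_simple n k (k + d) =
    k + (if int n dvd d then d + 1 else if int n dvd d - 1 then d - 1 else d)"
  by (auto simp: affine_simple_def)

text \<open>Every integer moves by at most 1, so only gaps 1 and 2 are in question. Gap 2 would
  collapse only if both \<open>a\<close> and \<open>a + 1\<close> were congruent to
  \<open>k\<close>, which \<open>n \<ge> 2\<close> excludes.\<close>

lemma affine_simple_less_iff:
  assumes n: "n \<ge> 2" and ab: "a < b"
  shows "affine_simple n k b < affine_simple n k a \<longleftrightarrow> b = a + 1 \<and> int n dvd a - k"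
    and "affine_simple n k a \<noteq> affine_simple n k b"
proof -
  define d where "d = a - k"
  define e where "e = b - k"
  have ab_eq: "a = k + d" "b = k + e" by (simp_all add: d_def e_def)
  have "e = d + 1 \<or> e = d + 2 \<or> e \<ge> d + 3" using ab ab_eq by linarith
  then have "(affine_simple n k b < affine_simple n k a \<longleftrightarrow> b = a + 1 \<and> int n dvd a - k)
      \<and> affine_simple n k a \<noteq> affine_simple n k b"
    using not_dvd_consecutive[OF n, of d] not_dvd_consecutive[OF n, of "d - 1"]
    unfolding ab_eq affine_simple_offset
    by (elim disjE) (auto simp: add.commute[of 1 d] split: if_splits)
  then show "affine_simple n k b < affine_simple n k a \<longleftrightarrow> b = a + 1 \<and> int n dvd a - k"
    "affine_simple n k a \<noteq> affine_simple n k b" by blast+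
qed

lemma affine_simple_involution:
  assumes "n \<ge> 2" shows "affine_simple n k (affine_simple n k a) = a"
proof -
  define d where "d = a - k"
  have a: "a = k + d" by (simp add: d_def)
  show ?thesis
    using not_dvd_consecutive[OF assms, of d] not_dvd_consecutive[OF assms, of "d - 1"]
    unfolding a affine_simple_offset by (simp add: affine_simple_offset)
qed

lemma affine_simple_period:
  "affine_simple n (k + int n * t) = affine_simple n k"
proof
  fix x
  have "int n dvd x - (c + int n * t) \<longleftrightarrow> int n dvd x - c" for c
    using dvd_diff_left_iff[of "int n" "int n * t" "x - c"] by (simp add: diff_diff_eq)
  from this[of k] this[of "k + 1"] show "affine_simple n (k + int n * t) x = affine_simple n k x"
    by (simp add: affine_simple_def algebra_simps)
qed

lemma affine_simple_affine_perms:
  assumes n: "n \<ge> 2"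
  shows "affine_simple n k \<in> affine_perms n"
proof -
  have "bij (affine_simple n k)"
    by (rule o_bij[of "affine_simple n k"]) (auto simp: affine_simple_involution[OF n])
  moreover have per: "affine_simple n k (i + int n) = affine_simple n k i + int n" for i
  proof -
    have "int n dvd i + int n - c \<longleftrightarrow> int n dvd i - c" for c
      using dvd_add_left_iff[of "int n" "int n" "i - c"] by (simp add: algebra_simps)
    then show ?thesis by (simp add: affine_simple_def)
  qed
  moreover have "(\<Sum>i\<in>{k..<k + int n}. affine_simple n k i - i) = 0"
  proof -
    have split: "{k..<k + int n} = insert k (insert (k + 1) {k + 2..<k + int n})"
      using n by auto
    have "affine_simple n k i = i" if "i \<in> {k + 2..<k + int n}" for i
    proof -
      have "\<not> int n dvd i - k" "\<not> int n dvd i - (k + 1)"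
        using that by (auto dest!: zdvd_imp_le)
      then show ?thesis by (simp add: affine_simple_def)
    qed
    then have "(\<Sum>i\<in>{k + 2..<k + int n}. affine_simple n k i - i) = 0" by simp
    moreover have "\<not> int n dvd 1" using n by simp
    ultimately show ?thesis unfolding split by (simp add: affine_simple_def)
  qed
  ultimately show ?thesis using n by (simp add: affine_perms_iff_displacement[of n _ k])
qed

lemma affine_generators_simple:
  assumes "n \<ge> 2" shows "affine_simple n k \<in> affine_generators n"
proof -
  have "k = 1 + (k - 1) mod int n + int n * ((k - 1) div int n)" by simp
  then have "affine_simple n k = affine_simple n (1 + (k - 1) mod int n)"
    by (metis affine_simple_period)
  moreover have "1 + (k - 1) mod int n \<in> {1..int n}"
    using assms pos_mod_bound[of "int n" "k - 1"] pos_mod_sign[of "int n" "k - 1"]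
    unfolding atLeastAtMost_iff by linarith
  ultimately show ?thesis using assms by (auto simp: affine_generators_def)
qed

lemma foldr_comp_append: "foldr (\<circ>) (xs @ ys) id = foldr (\<circ>) xs id \<circ> foldr (\<circ>) ys id"
  by (induction xs) (simp_all add: comp_assoc)

text \<open>Only the values \<open>k + int n * t\<close> and \<open>k + int n * t + 1\<close> change
  their relative order, and \<open>x\<close> takes them at the translates of \<open>p\<close> and
  \<open>q\<close>.\<close>

lemma inversions_affine_simple_comp:
  assumes n: "n \<ge> 2" and x: "x \<in> affine_perms n"
    and "p < q" and xp: "x p = k" and xq: "x q = k + 1"
  shows "inversions (affine_simple n k \<circ> x) =
    inversions x \<union> range (\<lambda>t. (p + int n * t, q + int n * t))"
proof -
  have orbit: "x i = k + int n * t \<longleftrightarrow> i = p + int n * t"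
    "x i = k + int n * t + 1 \<longleftrightarrow> i = q + int n * t" for i t
    using affine_perms_shift[OF x, of p t] affine_perms_shift[OF x, of q t]
      affine_perms_eq_iff[OF x] xp xq by (metis, metis add.commute add.left_commute)
  have key: "affine_simple n k (x j) < affine_simple n k (x i) \<longleftrightarrow>
      x j < x i \<or> (\<exists>t. (i, j) = (p + int n * t, q + int n * t))" if "i < j" for i j
  proof (cases "x i < x j")
    case True
    then have "affine_simple n k (x j) < affine_simple n k (x i) \<longleftrightarrow>
        x j = x i + 1 \<and> int n dvd x i - k"
      by (rule affine_simple_less_iff(1)[OF n])
    also have "\<dots> \<longleftrightarrow> (\<exists>t. x i = k + int n * t \<and> x j = k + int n * t + 1)"
      by (auto simp: dvd_def algebra_simps)
    finally show ?thesis using True orbit by auto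
  next
    case False
    then have less: "x j < x i"
      using that affine_perms_eq_iff[OF x, of i j] by fastforce
    have "\<not> (x i = x j + 1 \<and> int n dvd x j - k)"
    proof
      assume "x i = x j + 1 \<and> int n dvd x j - k"
      then obtain t where "x j = k + int n * t" "x i = k + int n * t + 1"
        by (auto simp: dvd_def algebra_simps)
      then show False using orbit that \<open>p < q\<close> by auto
    qed
    then show ?thesis
      using affine_simple_less_iff[OF n less, of k] less by auto
  qed
  then show ?thesis using \<open>p < q\<close> by (auto simp: inversions_def)
qed

lemma inversion_number_ascent:
  assumes n: "n \<ge> 2" and x: "x \<in> affine_perms n"
    and "p < q" and xp: "x p = k" and xq: "x q = k + 1"
  shows "inversion_number n (affine_simple n k \<circ> x) = Suc (inversion_number n x)"
proof -
  \<comment> \<open>The only translate that carries \<open>p\<close> into \<open>{1..int n}\<close>;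
    hence exactly one pair of the new orbit is counted.\<close>
  define t where "t = - ((p - 1) div int n)"
  have window: "p + int n * s \<in> {1..int n} \<longleftrightarrow> s = t" for s
  proof
    assume "p + int n * s \<in> {1..int n}"
    then have "(p - 1 + int n * s) div int n = 0" using n by (intro div_pos_pos_trivial) auto
    then show "s = t" using n by (simp add: t_def)
  next
    assume "s = t"
    then have "p + int n * s = 1 + (p - 1) mod int n"
      by (simp add: t_def minus_div_mult_eq_mod[symmetric] algebra_simps)
    then show "p + int n * s \<in> {1..int n}"
      using n pos_mod_bound[of "int n" "p - 1"] pos_mod_sign[of "int n" "p - 1"]
      unfolding atLeastAtMost_iff by linarith
  qed
  have "inversions (affine_simple n k \<circ> x) \<inter> {1..int n} \<times> UNIV =
      insert (p + int n * t, q + int n * t) (inversions x \<inter> {1..int n} \<times> UNIV)"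
    using inversions_affine_simple_comp[OF assms] window by auto
  moreover have "(p + int n * t, q + int n * t) \<notin> inversions x"
    using x xp xq by (auto simp: inversions_def affine_perms_shift)
  ultimately show ?thesis
    using finite_inversion_window[OF _ x] n by (simp add: inversion_number_def)
qed

text \<open>If \<open>k + 1\<close> stands left of \<open>k\<close> in \<open>x\<close>, the product
  has an ascent at these positions and multiplying by the generator again returns \<open>x\<close>,
  so the number drops by one.\<close>

lemma inversion_number_affine_simple_le:
  assumes n: "n \<ge> 2" and x: "x \<in> affine_perms n"
  shows "inversion_number n (affine_simple n k \<circ> x) \<le> Suc (inversion_number n x)"
proof (cases "inv x k < inv x (k + 1)")
  case True
  then show ?thesis using inversion_number_ascent[OF n x True] by (simp add: affine_perms_inv_apply[OF x])
next
  case False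
  let ?y = "affine_simple n k \<circ> x"
  have s: "affine_simple n k k = k + 1" "affine_simple n k (k + 1) = k"
    using n by (simp_all add: affine_simple_def)
  have y: "?y \<in> affine_perms n"
    using n x affine_simple_affine_perms affine_perms_comp by simp
  have "inv x k \<noteq> inv x (k + 1)" using x by (metis affine_perms_inv_apply(1) add_cancel_left_right zero_neq_one)
  then have "inv x (k + 1) < inv x k" using False by simp
  then have "inversion_number n (affine_simple n k \<circ> ?y) = Suc (inversion_number n ?y)"
    using s by (intro inversion_number_ascent[OF n y]) (auto simp: affine_perms_inv_apply[OF x])
  moreover have "affine_simple n k \<circ> ?y = x"
    by (auto simp: affine_simple_involution[OF n])
  ultimately show ?thesis by simp
qed

text \<open>Starting from an arbitrary \<open>x\<close> instead of \<open>id\<close> bounds from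
  below the length of every word for \<open>y \<circ> inv x\<close>, not only for
  \<open>y\<close>.\<close>

lemma inversion_number_product_le:
  assumes n: "n \<ge> 1" and "set gs \<subseteq> affine_generators n" and x: "x \<in> affine_perms n"
  shows "foldr (\<circ>) gs id \<circ> x \<in> affine_perms n \<and>
    inversion_number n (foldr (\<circ>) gs id \<circ> x) \<le> length gs + inversion_number n x"
  using assms(2)
proof (induction gs)
  case (Cons g gs)
  let ?y = "foldr (\<circ>) gs id \<circ> x"
  from Cons.prems obtain k where k: "n \<ge> 2" "g = affine_simple n k"
    by (auto simp: affine_generators_def split: if_splits)
  have "set gs \<subseteq> affine_generators n" using Cons.prems by simp
  from Cons.IH[OF this] have "?y \<in> affine_perms n"
    "inversion_number n ?y \<le> length gs + inversion_number n x" by blast+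
  then have "affine_simple n k \<circ> ?y \<in> affine_perms n"
    "inversion_number n (affine_simple n k \<circ> ?y) \<le> length (g # gs) + inversion_number n x"
    using inversion_number_affine_simple_le[OF k(1), of ?y k]
      affine_perms_comp[OF n affine_simple_affine_perms[OF k(1)], of ?y k] by auto
  moreover have "affine_simple n k \<circ> ?y = foldr (\<circ>) (g # gs) id \<circ> x"
    by (simp add: k comp_assoc)
  ultimately show ?case by (simp only:)
qed (simp add: x)

text \<open>If \<open>y \<circ> inv x\<close> is not the identity, it has a descent at some
  \<open>k\<close>. Containment forces \<open>k\<close> to stand left of \<open>k + 1\<close> in
  \<open>x\<close>, so their positions are an inversion of \<open>y\<close> but not of
  \<open>x\<close>. Swapping the two values adds only the orbit of this pair, and the inversions
  stay within those of \<open>y\<close>.\<close>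

lemma reduced_word_exists:
  assumes n: "n \<ge> 1" and x: "x \<in> affine_perms n" and y: "y \<in> affine_perms n"
    and "inversions x \<subseteq> inversions y"
  shows "\<exists>gs. set gs \<subseteq> affine_generators n \<and>
    length gs + inversion_number n x = inversion_number n y \<and> y = foldr (\<circ>) gs id \<circ> x"
  using x assms(4)
proof (induction "inversion_number n y - inversion_number n x" arbitrary: x rule: less_induct)
  case (less x)
  note x = less.prems(1) and sub = less.prems(2)
  let ?z = "y \<circ> inv x"
  have z: "?z \<in> affine_perms n" using n x y affine_perms_comp affine_perms_inv by blast
  show ?case
  proof (cases "\<forall>k. ?z k < ?z (k + 1)")
    case True
    then have "?z = id" using affine_perm_increasing_eq_id[OF n z] by blast
    then have "y = x" by (metis affine_perms_inv_apply(2)[OF x] comp_apply id_apply ext)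
    then show ?thesis by (intro exI[of _ "[]"]) auto
  next
    case False
    then obtain k where k: "?z (k + 1) \<le> ?z k" by (auto simp: not_less)
    define p q where "p = inv x k" and "q = inv x (k + 1)"
    have xpq: "x p = k" "x q = k + 1" by (simp_all add: p_def q_def affine_perms_inv_apply[OF x])
    have "q \<noteq> p" using xpq by auto
    then have ypq: "y q < y p"
      using k affine_perms_eq_iff[OF y, of p q] by (simp add: p_def q_def)
    have "p < q"
    proof (rule ccontr)
      assume "\<not> p < q"
      then have "(q, p) \<in> inversions x" using \<open>q \<noteq> p\<close> xpq by (auto simp: inversions_def)
      then show False using sub ypq by (auto simp: inversions_def)
    qed
    have n2: "n \<ge> 2"
    proof (rule ccontr)
      assume "\<not> n \<ge> 2"
      then have "n = 1" using n by simp
      then show False using k affine_permsD(2)[OF z, of k] by simp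
    qed
    let ?x = "affine_simple n k \<circ> x"
    have x': "?x \<in> affine_perms n"
      using n x affine_simple_affine_perms[OF n2] affine_perms_comp by blast
    have sub': "inversions ?x \<subseteq> inversions y"
      unfolding inversions_affine_simple_comp[OF n2 x \<open>p < q\<close> xpq]
      using sub ypq \<open>p < q\<close> y by (auto simp: inversions_def affine_perms_shift)
    have num: "inversion_number n ?x = Suc (inversion_number n x)"
      by (rule inversion_number_ascent[OF n2 x \<open>p < q\<close> xpq])
    have "inversion_number n ?x \<le> inversion_number n y"
      using sub' finite_inversion_window[OF n y] unfolding inversion_number_def
      by (intro card_mono) auto
    then have "inversion_number n y - inversion_number n ?x <
        inversion_number n y - inversion_number n x" using num by simp
    from less.hyps[OF this x' sub'] obtain gs where gs: "set gs \<subseteq> affine_generators n"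
      "length gs + inversion_number n ?x = inversion_number n y"
      "y = foldr (\<circ>) gs id \<circ> ?x" by blast
    have "foldr (\<circ>) (gs @ [affine_simple n k]) id \<circ> x = y"
      unfolding foldr_comp_append using gs(3) by (simp add: comp_assoc)
    then show ?thesis
      using gs num affine_generators_simple[OF n2, of k]
      by (intro exI[of _ "gs @ [affine_simple n k]"]) auto
  qed
qed

lemma inversions_id: "inversions id = {}"
  by (auto simp: inversions_def)

text \<open>The climb from \<open>x\<close> to \<open>y\<close> yields a word of the required
  length, and counting inversions shows that no word is shorter. The case \<open>x = id\<close>
  identifies length with inversion number.\<close>

lemma coxeter_length_comp_inv:
  assumes n: "n \<ge> 1" and x: "x \<in> affine_perms n" and y: "y \<in> affine_perms n"
    and sub: "inversions x \<subseteq> inversions y"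
  shows "coxeter_length n (y \<circ> inv x) + inversion_number n x = inversion_number n y"
proof -
  obtain gs where gs: "set gs \<subseteq> affine_generators n"
    "length gs + inversion_number n x = inversion_number n y" "y = foldr (\<circ>) gs id \<circ> x"
    using reduced_word_exists[OF assms] by blast
  have "y \<circ> inv x = foldr (\<circ>) gs id"
    unfolding gs(3) by (auto simp: fun_eq_iff affine_perms_inv_apply[OF x])
  moreover have "length gs \<le> length hs"
    if "set hs \<subseteq> affine_generators n" "y \<circ> inv x = foldr (\<circ>) hs id" for hs
  proof -
    have "foldr (\<circ>) hs id \<circ> x = y" by (auto simp: that(2)[symmetric] affine_perms_inv_apply[OF x])
    then show ?thesis using inversion_number_product_le[OF n that(1) x] gs(2) by simp
  qed
  ultimately have "coxeter_length n (y \<circ> inv x) = length gs"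
    unfolding coxeter_length_def using gs(1) by (intro Least_equality) auto
  then show ?thesis using gs(2) by simp
qed

lemma coxeter_length_eq_inversion_number:
  assumes "n \<ge> 1" "y \<in> affine_perms n"
  shows "coxeter_length n y = inversion_number n y"
  using coxeter_length_comp_inv[OF assms(1) id_affine_perms assms(2)]
  by (simp add: inversions_id inversion_number_def)

lemma left_weak_le_if_inversions_subset:
  assumes "n \<ge> 1" "x \<in> affine_perms n" "y \<in> affine_perms n" "inversions x \<subseteq> inversions y"
  shows "left_weak_le n x y"
  using coxeter_length_comp_inv[OF assms] assms
  by (simp add: left_weak_le_def coxeter_length_eq_inversion_number flip: of_nat_add)

text \<open>The two relations make the lengths of \<open>y \<circ> inv x\<close> and
  \<open>x \<circ> inv y\<close> opposite numbers, hence both 0.\<close>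

lemma left_weak_le_antisym:
  assumes n: "n \<ge> 1" and x: "x \<in> affine_perms n" and y: "y \<in> affine_perms n"
    and "left_weak_le n x y" "left_weak_le n y x"
  shows "x = y"
proof -
  let ?z = "y \<circ> inv x"
  have z: "?z \<in> affine_perms n" using n x y affine_perms_comp affine_perms_inv by blast
  have "coxeter_length n ?z = 0" using assms(4,5) by (simp add: left_weak_le_def)
  then have "inversion_number n ?z = 0" using coxeter_length_eq_inversion_number[OF n z] by simp
  moreover obtain gs where "length gs + inversion_number n id = inversion_number n ?z"
      "?z = foldr (\<circ>) gs id \<circ> id"
    using reduced_word_exists[OF n id_affine_perms z] by (auto simp: inversions_id)
  ultimately have "?z = id" by simp
  then show ?thesis by (metis affine_perms_inv_apply(2)[OF x] comp_apply id_apply ext)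
qed

section \<open>Minimal elements of affine sylvester classes\<close>

text \<open>Position \<open>j > i\<close> precedes \<open>i\<close> in postorder iff it is a descendant of \<open>i\<close>.\<close>

definition right_descendants :: "(int \<Rightarrow> int) \<Rightarrow> (int \<times> int) set" where
  "right_descendants w = {(i, j). i < j \<and> (\<forall>k\<in>{i<..j}. w k < w i)}"

lemma finite_argmax_exists:
  fixes f :: "'a \<Rightarrow> 'b :: linorder"
  assumes "finite S" "S \<noteq> {}"
  shows "\<exists>m\<in>S. \<forall>k\<in>S. f k \<le> f m"
proof -
  have "Max (f ` S) \<in> f ` S" using assms by simp
  then obtain m where "m \<in> S" "f m = Max (f ` S)" by force
  then show ?thesis using assms by (metis Max_ge finite_imageI imageI)
qed

lemma incomparable_pos_iff:
  assumes "i < j"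
  shows "incomparable_pos w i j \<longleftrightarrow> (\<exists>k\<in>{i<..<j}. max (w i) (w j) < w k)"
    and "incomparable_pos w j i \<longleftrightarrow> (\<exists>k\<in>{i<..<j}. max (w i) (w j) < w k)"
  using assms by (auto simp: incomparable_pos_def)

text \<open>Expresses right descendants through the descendant order alone, so that all members of a
  sylvester class share them.\<close>

lemma right_descendants_iff_desc_le:
  assumes "inj w" shows "(i, j) \<in> right_descendants w \<longleftrightarrow> i < j \<and> desc_le w j i"
proof -
  have "(\<forall>k\<in>{i<..j}. w k < w i) \<longleftrightarrow> w j < w i \<and> (\<forall>k\<in>{i<..<j}. \<not> max (w i) (w j) < w k)"
    if "i < j"
  proof (intro iffI conjI ballI)
    fix k assume *: "w j < w i \<and> (\<forall>k\<in>{i<..<j}. \<not> max (w i) (w j) < w k)" "k \<in> {i<..j}"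
    have "w k \<noteq> w i" using * assms by (auto simp: inj_eq)
    moreover have "w k \<le> w i" using * by (cases "k = j") (auto simp: not_less)
    ultimately show "w k < w i" by simp
  next
    assume *: "\<forall>k\<in>{i<..j}. w k < w i"
    then show "w j < w i" using that by simp
    fix k assume "k \<in> {i<..<j}"
    then have "w k < w i" using * by simp
    then show "\<not> max (w i) (w j) < w k" by simp
  qed
  then show ?thesis using incomparable_pos_iff(2)[of i j w]
    by (auto simp: right_descendants_def desc_le_def)
qed

lemma left_descendants_iff_desc_le:
  assumes "inj w" "i < j" shows "desc_le w i j \<longleftrightarrow> (\<forall>k\<in>{i..<j}. w k < w j)"
proof -
  have "(\<forall>k\<in>{i..<j}. w k < w j) \<longleftrightarrow> w i < w j \<and> (\<forall>k\<in>{i<..<j}. \<not> max (w i) (w j) < w k)"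
  proof (intro iffI conjI ballI)
    fix k assume *: "w i < w j \<and> (\<forall>k\<in>{i<..<j}. \<not> max (w i) (w j) < w k)" "k \<in> {i..<j}"
    have "w k \<noteq> w j" using * assms by (auto simp: inj_eq)
    moreover have "w k \<le> w j" using * by (cases "k = i") (fastforce simp: not_less)+
    ultimately show "w k < w j" by simp
  next
    assume *: "\<forall>k\<in>{i..<j}. w k < w j"
    then show "w i < w j" using assms(2) by simp
    fix k assume "k \<in> {i<..<j}"
    then have "w k < w j" using * by simp
    then show "\<not> max (w i) (w j) < w k" by simp
  qed
  then show ?thesis using incomparable_pos_iff(1)[of i j w] assms(2)
    by (auto simp: desc_le_def)
qed

text \<open>Places the postorder labelling \<open>u\<close> in the class of \<open>w\<close>. Its
  inversions record right descendants directly; left descendants have to be recovered from the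
  absence of inversions.\<close>

lemma desc_le_eq_if_inversions_eq:
  assumes w: "inj w" and u: "inj u" and inv: "inversions u = right_descendants w"
  shows "desc_le u = desc_le w"
proof (intro ext)
  fix i j :: int
  have u_less: "u j < u i \<longleftrightarrow> (i, j) \<in> right_descendants w" if "i < j" for i j
    using inv that by (auto simp: inversions_def)
  consider "i = j" | "i < j" | "j < i" by linarith
  then show "desc_le u i j = desc_le w i j"
  proof cases
    case 3
    have "(\<forall>k\<in>{j<..i}. u k < u j) \<longleftrightarrow> (\<forall>k\<in>{j<..i}. w k < w j)"
      using u_less 3 by (fastforce simp: right_descendants_def)
    then show ?thesis
      using 3 right_descendants_iff_desc_le[OF w, of j i] right_descendants_iff_desc_le[OF u, of j i]
      by (simp add: right_descendants_def)
  next
    case 2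
    have "u k < u j \<longleftrightarrow> (\<exists>l\<in>{k<..j}. w k < w l)" if "k < j" for k
    proof -
      have "u k < u j \<longleftrightarrow> \<not> u j < u k"
        using u that by (metis injD less_irrefl not_less_iff_gr_or_eq)
      also have "\<dots> \<longleftrightarrow> (\<exists>l\<in>{k<..j}. \<not> w l < w k)"
        unfolding u_less[OF that] using that by (auto simp: right_descendants_def)
      also have "\<dots> \<longleftrightarrow> (\<exists>l\<in>{k<..j}. w k < w l)"
      proof -
        have "\<not> w l < w k \<longleftrightarrow> w k < w l" if "l \<in> {k<..j}" for l
          using that w by (metis greaterThanAtMost_iff injD less_irrefl not_less_iff_gr_or_eq)
        then show ?thesis by blast
      qed
      finally show ?thesis .
    qed
    then have "(\<forall>k\<in>{i..<j}. u k < u j) \<longleftrightarrow> (\<forall>k\<in>{i..<j}. \<exists>l\<in>{k<..j}. w k < w l)" by auto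
    \<comment> \<open>If every position of \<open>{i..<j}\<close> is exceeded by a later one up to
      \<open>j\<close>, the maximum over \<open>{i..j}\<close> can only sit at
      \<open>j\<close>.\<close>
    also have "\<dots> \<longleftrightarrow> (\<forall>k\<in>{i..<j}. w k < w j)"
    proof
      assume *: "\<forall>k\<in>{i..<j}. \<exists>l\<in>{k<..j}. w k < w l"
      obtain m where m: "m \<in> {i..j}" "\<And>k. k \<in> {i..j} \<Longrightarrow> w k \<le> w m"
        using finite_argmax_exists[of "{i..j}" w] 2 by auto
      have "m = j"
      proof (rule ccontr)
        assume "m \<noteq> j"
        then obtain l where "l \<in> {m<..j}" "w m < w l" using * m(1) by force
        then show False using m(2)[of l] m(1) by auto
      qed
      show "\<forall>k\<in>{i..<j}. w k < w j"
      proof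
        fix k assume k: "k \<in> {i..<j}"
        then have "w k \<noteq> w j" using w by (auto simp: inj_eq)
        then show "w k < w j" using m(2)[of k] k \<open>m = j\<close> by simp
      qed
    qed auto
    finally show ?thesis
      using left_descendants_iff_desc_le[OF w 2] left_descendants_iff_desc_le[OF u 2] by simp
  qed (simp add: desc_le_def)
qed

text \<open>The inversions of \<open>u\<close> are the right descendants common to the whole class,
  and those are inversions of every member. So \<open>u\<close> lies below the entire class and, by
  antisymmetry, is its only minimal element.\<close>

lemma pi_down_eqI:
  assumes n: "n \<ge> 1" and w: "w \<in> affine_perms n" and u: "u \<in> affine_perms n"
    and inv: "inversions u = right_descendants w"
  shows "pi_down n w = u"
proof -
  have inj: "inj x" if "x \<in> affine_perms n" for x
    using affine_permsD(1)[OF that] by (rule bij_is_inj)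
  have u_class: "u \<in> syl_class n w"
    using u desc_le_eq_if_inversions_eq[OF inj[OF w] inj[OF u] inv] by (simp add: syl_class_def)
  have u_le: "left_weak_le n u x" if "x \<in> syl_class n w" for x
  proof -
    from that have x: "x \<in> affine_perms n" and eq: "desc_le x = desc_le w"
      by (auto simp: syl_class_def)
    have "right_descendants w = right_descendants x"
      using right_descendants_iff_desc_le[OF inj[OF w]] right_descendants_iff_desc_le[OF inj[OF x]] eq
      by auto
    also have "\<dots> \<subseteq> inversions x" by (auto simp: right_descendants_def inversions_def)
    finally show ?thesis using inv left_weak_le_if_inversions_subset[OF n u x] by simp
  qed
  show ?thesis unfolding pi_down_def
  proof (rule the_equality)
    show "u \<in> syl_class n w \<and> (\<forall>x\<in>syl_class n w. left_weak_le n x u \<longrightarrow> x = u)"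
      using u_class u_le u left_weak_le_antisym[OF n] by (auto simp: syl_class_def)
  qed (use u_class u_le in blast)
qed

section \<open>The finite stack-sorting map\<close>

lemma stack_sort_induct [consumes 1, case_names Nil Max]:
  assumes "distinct xs" and "P []"
    and step: "\<And>L m R. \<lbrakk>distinct (L @ m # R); \<And>x. x \<in> set L \<union> set R \<Longrightarrow> x < m; P L; P R\<rbrakk>
      \<Longrightarrow> P (L @ m # R)"
  shows "P (xs :: int list)"
  using \<open>distinct xs\<close>
proof (induction "length xs" arbitrary: xs rule: less_induct)
  case less
  show ?case
  proof (cases "xs = []")
    case False
    then have "Max (set xs) \<in> set xs" by simp
    then obtain L R where xs: "xs = L @ Max (set xs) # R" by (meson split_list)
    have bound: "x < Max (set xs)" if "x \<in> set L \<union> set R" for x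
    proof -
      have "x \<in> set xs" using that by (subst xs) auto
      moreover have "x \<noteq> Max (set xs)"
        using less.prems that by (subst (asm) xs) auto
      ultimately show ?thesis by (simp add: order_less_le)
    qed
    have "length L < length xs" "length R < length xs" "distinct L" "distinct R"
      using arg_cong[OF xs, of length] arg_cong[OF xs, of distinct] less.prems by auto
    then have "P L" "P R" using less.hyps by blast+
    then show ?thesis using step[of L "Max (set xs)" R] bound less.prems xs by metis
  qed (simp add: \<open>P []\<close>)
qed

lemma
  assumes "distinct xs"
  shows set_stack_sort: "set (stack_sort xs) = set xs"
    and length_stack_sort: "length (stack_sort xs) = length xs"
    and distinct_stack_sort: "distinct (stack_sort xs)"
proof -
  have "set (stack_sort xs) = set xs \<and> length (stack_sort xs) = length xs \<and> distinct (stack_sort xs)"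
    using assms
  proof (induction xs rule: stack_sort_induct)
    case (Max L m R)
    then show ?case by (subst stack_sort_decomp | force)+
  qed (simp add: stack_sort_Nil)
  then show "set (stack_sort xs) = set xs" "length (stack_sort xs) = length xs"
    "distinct (stack_sort xs)" by auto
qed

lemma stack_sort_map_add:
  assumes "distinct xs"
  shows "stack_sort (map (\<lambda>x. x + c) xs) = map (\<lambda>x. x + c) (stack_sort xs)"
  using assms
proof (induction xs rule: stack_sort_induct)
  case (Max L m R)
  have "stack_sort (map (\<lambda>x. x + c) L @ (m + c) # map (\<lambda>x. x + c) R) =
      stack_sort (map (\<lambda>x. x + c) L) @ stack_sort (map (\<lambda>x. x + c) R) @ [m + c]"
    using Max.hyps by (intro stack_sort_decomp) auto
  moreover have "stack_sort (L @ m # R) = stack_sort L @ stack_sort R @ [m]"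
    using Max.hyps by (intro stack_sort_decomp) auto
  ultimately show ?case using Max.IH by simp
qed (simp add: stack_sort_Nil)

lemma stack_sort_Cons_max:
  "(\<And>x. x \<in> set R \<Longrightarrow> x < m) \<Longrightarrow> stack_sort (m # R) = stack_sort R @ [m]"
  using stack_sort_decomp[of "[]" R m] by (simp add: stack_sort_Nil)

lemma finite_stack_sort_preimage: "finite (stack_sort_preimage z)"
proof (rule finite_subset)
  show "stack_sort_preimage z \<subseteq> {u. set u \<subseteq> set z \<and> length u = length z}"
    by (auto simp: stack_sort_preimage_def set_stack_sort length_stack_sort)
qed (simp add: finite_lists_length_eq)

text \<open>Induction along the recursion: \<open>s(L) s(R) m\<close> puts the left part before the
  right part before the maximum, which settles every pair not contained in one part. As the maximum
  moves from between the parts to the end, the right part shifts back by one place; hence the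
  starting point \<open>c\<close> in \<open>v\<close> is kept separate from
  \<open>a\<close>.\<close>

lemma stack_sort_interval_order:
  fixes w v :: "int \<Rightarrow> int"
  assumes "inj_on w {a..<b}"
    and "map v [c..c + (b - a) - 1] = stack_sort (map w [a..b - 1])"
    and "a \<le> i" "i < j" "j < b"
    and "i' \<in> {c..<c + (b - a)}" "j' \<in> {c..<c + (b - a)}" "v i' = w i" "v j' = w j"
  shows "j' < i' \<longleftrightarrow> (\<forall>k\<in>{i<..j}. w k < w i)"
  using assms
proof (induction "nat (b - a)" arbitrary: a b c i j i' j' rule: less_induct)
  case less
  note inj = less.prems(1) and eq = less.prems(2) and ij = less.prems(3-5)
    and pos = less.prems(6,7) and val = less.prems(8,9)
  obtain m where m: "m \<in> {a..<b}" and max: "\<And>k. k \<in> {a..<b} \<Longrightarrow> w k \<le> w m"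
    using finite_argmax_exists[of "{a..<b}" w] ij by auto
  have max_less: "w k < w m" if "k \<in> {a..<b}" "k \<noteq> m" for k
    using max[of k] inj_onD[OF inj, of k m] that m by force
  \<comment> \<open>In the sorted word, \<open>d\<close> is where the sorted right part starts and
    \<open>e\<close> is the place of the maximum.\<close>
  define d where "d = c + (m - a)"
  define e where "e = c + (b - a) - 1"
  have "a \<le> m" "m \<le> b - 1" using m by auto
  then have "[a..b - 1] = [a..m - 1] @ m # [m + 1..b - 1]" by (rule upto_split3)
  then have ws: "stack_sort (map w [a..b - 1]) =
      stack_sort (map w [a..m - 1]) @ stack_sort (map w [m + 1..b - 1]) @ [w m]"
    using max_less m by (simp only: map_append list.map) (subst stack_sort_decomp, auto)
  have cde: "c \<le> d" "d \<le> e" using m by (auto simp: d_def e_def)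
  have vs: "[c..e] = [c..d - 1] @ [d..e - 1] @ [e]"
    using cde by (metis upto_split1 upto_rec2)
  have dist: "distinct (map w [x..y - 1])" if "{x..<y} \<subseteq> {a..<b}" for x y
  proof -
    have "{x..y - 1} = {x..<y}" by auto
    then show ?thesis using inj that by (simp add: distinct_map inj_on_subset)
  qed
  have sub: "{a..<m} \<subseteq> {a..<b}" "{m + 1..<b} \<subseteq> {a..<b}" using m by auto
  have "map v [c..d - 1] @ map v [d..e - 1] @ [v e] =
      stack_sort (map w [a..m - 1]) @ stack_sort (map w [m + 1..b - 1]) @ [w m]"
    using eq ws vs by (simp add: e_def)
  moreover have "length (map v [c..d - 1]) = length (stack_sort (map w [a..m - 1]))"
    by (subst length_stack_sort[OF dist[OF sub(1)]]) (simp add: d_def)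
  ultimately have left: "map v [c..d - 1] = stack_sort (map w [a..m - 1])"
    and right: "map v [d..e - 1] = stack_sort (map w [m + 1..b - 1])" and last: "v e = w m"
    by auto
  have dist_v: "distinct (map v [c..e])"
    using distinct_stack_sort[OF dist[OF subset_refl]] eq by (simp add: e_def)
  then have inj_v: "inj_on v {c..e}" by (simp add: distinct_map)
  have in_ce: "i' \<in> {c..e}" "j' \<in> {c..e}" using pos by (auto simp: e_def)
  have in_left: "k' < d" if "k \<in> {a..<m}" "k' \<in> {c..e}" "v k' = w k" for k k'
  proof -
    have "w k \<in> set (stack_sort (map w [a..m - 1]))"
      using that(1) by (subst set_stack_sort[OF dist[OF sub(1)]]) auto
    then obtain l where "l \<in> {c..d - 1}" "v l = w k" by (auto simp flip: left)
    moreover from this have "l = k'"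
      using inj_onD[OF inj_v, of l k'] that cde by auto
    ultimately show ?thesis by simp
  qed
  have in_right: "d \<le> k' \<and> k' < e" if "k \<in> {m + 1..<b}" "k' \<in> {c..e}" "v k' = w k" for k k'
  proof -
    have "w k \<in> set (stack_sort (map w [m + 1..b - 1]))"
      using that(1) by (subst set_stack_sort[OF dist[OF sub(2)]]) auto
    then obtain l where "l \<in> {d..e - 1}" "v l = w k" by (auto simp flip: right)
    moreover from this have "l = k'"
      using inj_onD[OF inj_v, of l k'] that cde by auto
    ultimately show ?thesis by simp
  qed
  have at_end: "k' = e" if "k' \<in> {c..e}" "v k' = w m" for k'
    using inj_onD[OF inj_v, of k' e] that cde last by auto
  have "i' \<noteq> j'" using val inj_onD[OF inj, of i j] ij by auto
  consider "i = m" | "j = m" | "i < m" "m < j" | "j < m" | "m < i" using ij by linarith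
  then show ?case
  proof cases
    case 1
    have "j' < i'" using at_end[of i'] in_ce val \<open>i' \<noteq> j'\<close> 1 by auto
    moreover have "\<forall>k\<in>{i<..j}. w k < w i" using max_less ij 1 by auto
    ultimately show ?thesis by simp
  next
    case 2
    have "i' < j'" using at_end[of j'] in_ce val \<open>i' \<noteq> j'\<close> 2 by auto
    moreover have "\<not> w j < w i" using max[of i] ij 2 by auto
    ultimately show ?thesis using ij by auto
  next
    case 3
    have "i' < j'" using in_left[of i i'] in_right[of j j'] in_ce val ij 3 by auto
    moreover have "\<not> w m < w i" using max[of i] ij by auto
    ultimately show ?thesis using 3 by auto
  next
    case 4
    then have "i' < d" "j' < d" using in_left[of i i'] in_left[of j j'] in_ce val ij by auto
    then show ?thesis
      using 4 ij m in_ce val left inj_on_subset[OF inj sub(1)]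
      by (intro less.hyps[of m a c]) (auto simp: d_def)
  next
    case 5
    then have "d \<le> i' \<and> i' < e" "d \<le> j' \<and> j' < e"
      using in_right[of i i'] in_right[of j j'] in_ce val ij by auto
    moreover have "e = d + (b - (m + 1))" by (simp add: d_def e_def)
    ultimately show ?thesis
      using 5 ij m val right inj_on_subset[OF inj sub(2)]
      by (intro less.hyps[of b "m + 1" d]) auto
  qed
qed

section \<open>Periodic sets of positions\<close>

text \<open>\<open>A\<close> holds the block starts: the blocks are \<open>{a..<nxt a}\<close> for
  \<open>a \<in> A\<close>, and \<open>prv i\<close> is the start of the block containing
  \<open>i\<close>.\<close>

locale periodic_positions =
  fixes n :: nat and A :: "int set"
  assumes n_pos: "n \<ge> 1" and nonempty: "A \<noteq> {}" and periodic: "periodic_set n A"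
begin

lemma shift_mem: "i + int n * k \<in> A \<longleftrightarrow> i \<in> A"
proof (induction k rule: int_induct[where k = 0])
  case (step1 k)
  have "i + int n * (k + 1) = i + int n * k + int n" by (simp add: algebra_simps)
  then show ?case using step1 periodic by (metis periodic_set_def)
next
  case (step2 k)
  have "i + int n * k = i + int n * (k - 1) + int n" by (simp add: algebra_simps)
  then show ?case using step2 periodic by (metis periodic_set_def)
qed simp

definition nxt :: "int \<Rightarrow> int" where "nxt i = Min (A \<inter> {i<..i + int n})"
definition prv :: "int \<Rightarrow> int" where "prv i = Max (A \<inter> {i - int n<..i})"

lemma window_nonempty: "A \<inter> {i<..i + int n} \<noteq> {}"
proof -
  obtain c where c: "c \<in> A" using nonempty by blast
  define r where "r = (c - i - 1) mod int n"
  have "i + 1 + r = c + int n * - ((c - i - 1) div int n)"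
    by (simp add: r_def minus_div_mult_eq_mod[symmetric] algebra_simps)
  then have "i + 1 + r \<in> A" using c shift_mem by metis
  moreover have "0 \<le> r" "r < int n" using n_pos by (simp_all add: r_def)
  ultimately show ?thesis by force
qed

lemma nxt_props: "nxt i \<in> A" "i < nxt i" "nxt i \<le> i + int n"
  using Min_in[OF _ window_nonempty[of i]] by (auto simp: nxt_def)

lemma nxt_le: assumes "a \<in> A" "i < a" shows "nxt i \<le> a"
proof (cases "a \<le> i + int n")
  case True
  then show ?thesis using assms unfolding nxt_def by (intro Min_le) auto
qed (use nxt_props(3)[of i] in linarith)

lemma prv_props: "prv i \<in> A" "prv i \<le> i"
  using Max_in[OF _ window_nonempty[of "i - int n"]] by (auto simp: prv_def)

lemma le_prv: assumes "a \<in> A" "a \<le> i" shows "a \<le> prv i"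
proof (cases "i - int n < a")
  case True
  then show ?thesis using assms unfolding prv_def by (intro Max_ge) auto
next
  case False
  have "prv i > i - int n"
    using Max_in[OF _ window_nonempty[of "i - int n"]] by (auto simp: prv_def)
  then show ?thesis using False by simp
qed

lemma less_nxt_prv: "i < nxt (prv i)"
  using le_prv[OF nxt_props(1), of "prv i" i] nxt_props(2)[of "prv i"] by linarith

lemma nxt_eqI: "\<lbrakk>b \<in> A; i < b; \<And>a. a \<in> A \<Longrightarrow> i < a \<Longrightarrow> b \<le> a\<rbrakk> \<Longrightarrow> nxt i = b"
  using nxt_props[of i] nxt_le[of b i] by (intro order_antisym) auto

lemma prv_eqI:
  assumes "a \<in> A" "a \<le> i" "i < nxt a" shows "prv i = a"
proof (rule order_antisym[OF _ le_prv])
  show "prv i \<le> a" using nxt_le[OF prv_props(1), of a i] assms(3) prv_props(2)[of i] by linarith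
qed (use assms in auto)

lemma nxt_shift: "nxt (i + int n * k) = nxt i + int n * k"
proof (rule nxt_eqI)
  fix a assume "a \<in> A" "i + int n * k < a"
  then show "nxt i + int n * k \<le> a"
    using nxt_le[of "a + int n * (- k)" i] shift_mem[of a "- k"] by simp
qed (simp_all add: shift_mem nxt_props)

lemma prv_shift: "prv (i + int n * k) = prv i + int n * k"
  by (rule prv_eqI) (simp_all add: shift_mem prv_props nxt_shift less_nxt_prv)

lemma nxt_prv_pred: "b \<in> A \<Longrightarrow> nxt (prv (b - 1)) = b"
  using less_nxt_prv[of "b - 1"] nxt_le[of b "prv (b - 1)"] prv_props(2)[of "b - 1"] by force

text \<open>A window that starts in \<open>A\<close> also ends at a block boundary, so it cuts no
  block.\<close>

lemma block_subset_window:
  assumes "c \<in> A" "i \<in> {c..<c + int n}"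
  shows "{prv i..<nxt (prv i)} \<subseteq> {c..<c + int n}"
proof -
  have "c + int n \<in> A" using assms(1) shift_mem[of c 1] by simp
  then have "nxt (prv i) \<le> c + int n" using nxt_le prv_props(2)[of i] assms(2) by force
  moreover have "c \<le> prv i" using assms le_prv by auto
  ultimately show ?thesis by auto
qed

text \<open>Writes the word \<open>F a\<close> onto the block starting at \<open>a\<close>; this is
  meaningful when each word has the length of its block.\<close>

definition glue :: "(int \<Rightarrow> int list) \<Rightarrow> int \<Rightarrow> int" where
  "glue F i = F (prv i) ! nat (i - prv i)"

lemma map_glue:
  assumes a: "a \<in> A" and len: "length (F a) = nat (nxt a - a)"
  shows "map (glue F) [a..nxt a - 1] = F a"
proof (rule nth_equalityI)
  fix t assume "t < length (map (glue F) [a..nxt a - 1])"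
  then have t: "int t < nxt a - a" by simp
  then have "prv (a + int t) = a" using a by (intro prv_eqI) auto
  then show "map (glue F) [a..nxt a - 1] ! t = F a ! t" using t by (simp add: glue_def)
qed (simp add: len)

text \<open>Rearranging the values of \<open>w\<close> inside blocks stays bijective because blocks
  partition the positions, and it leaves the sum over a window starting in \<open>A\<close>
  unchanged.\<close>

lemma
  assumes w: "w \<in> affine_perms n"
    and dist: "\<And>a. a \<in> A \<Longrightarrow> distinct (F a)"
    and set: "\<And>a. a \<in> A \<Longrightarrow> set (F a) = w ` {a..<nxt a}"
    and per: "\<And>a. a \<in> A \<Longrightarrow> F (a + int n) = map (\<lambda>x. x + int n) (F a)"
  shows glue_affine_perms: "glue F \<in> affine_perms n"
    and map_glue_rearrangement: "\<And>a. a \<in> A \<Longrightarrow> map (glue F) [a..nxt a - 1] = F a"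
proof -
  have inj_w: "inj_on w S" for S
    by (rule inj_onI) (simp add: affine_perms_eq_iff[OF w])
  have len: "length (F a) = nat (nxt a - a)" if "a \<in> A" for a
    using distinct_card[OF dist[OF that]] set[OF that] card_image[OF inj_w, of "{a..<nxt a}"] by simp
  show blk: "map (glue F) [a..nxt a - 1] = F a" if "a \<in> A" for a
    using map_glue that len by blast
  have img: "glue F ` {a..<nxt a} = w ` {a..<nxt a}" if "a \<in> A" for a
  proof -
    have "{a..nxt a - 1} = {a..<nxt a}" by auto
    then show ?thesis using arg_cong[OF blk[OF that], of set] set[OF that] by simp
  qed
  have mem: "i \<in> {prv i..<nxt (prv i)}" for i
    using prv_props(2) less_nxt_prv by simp
  have inj: "inj (glue F)"
  proof (rule injI)
    fix i j assume eq: "glue F i = glue F j"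
    have "glue F i \<in> w ` {prv i..<nxt (prv i)}" "glue F j \<in> w ` {prv j..<nxt (prv j)}"
      using img[OF prv_props(1)] mem by blast+
    then obtain k where "k \<in> {prv i..<nxt (prv i)}" "k \<in> {prv j..<nxt (prv j)}"
      using eq affine_perms_eq_iff[OF w] by (metis imageE)
    then have "prv k = prv i" "prv k = prv j" by (auto intro: prv_eqI prv_props)
    then have same: "prv j = prv i" by simp
    have "{prv i..nxt (prv i) - 1} = {prv i..<nxt (prv i)}" by auto
    then have "inj_on (glue F) {prv i..<nxt (prv i)}"
      using blk[OF prv_props(1)[of i]] dist[OF prv_props(1)[of i]] by (metis distinct_map set_upto)
    then show "i = j" using eq mem[of i] mem[of j] same by (auto dest: inj_onD)
  qed
  moreover have "surj (glue F)"
  proof (rule surjI)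
    fix y
    have "y \<in> w ` {prv (inv w y)..<nxt (prv (inv w y))}"
      using mem affine_perms_inv_apply(1)[OF w] by (metis image_eqI)
    then have "y \<in> range (glue F)" using img[OF prv_props(1)[of "inv w y"]] by blast
    then show "glue F (inv (glue F) y) = y" by (rule f_inv_into_f)
  qed
  moreover have "glue F (i + int n) = glue F i + int n" for i
  proof -
    have "nat (i - prv i) < length (F (prv i))"
      using len[OF prv_props(1)[of i]] mem[of i] by simp
    then show ?thesis
      using prv_shift[of i 1] per[OF prv_props(1)[of i]] by (simp add: glue_def)
  qed
  moreover obtain c where c: "c \<in> A" using nonempty by blast
  have "(\<Sum>i\<in>{c..<c + int n}. glue F i - i) = 0"
  proof -
    let ?I = "{c..<c + int n}"
    have sub: "glue F ` ?I \<subseteq> w ` ?I"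
    proof
      fix y assume "y \<in> glue F ` ?I"
      then obtain i where "i \<in> ?I" "y = glue F i" by blast
      then show "y \<in> w ` ?I"
        using img[OF prv_props(1)[of i]] mem[of i] block_subset_window[OF c] by blast
    qed
    have inj': "inj_on (glue F) ?I" using inj by (rule inj_on_subset) simp
    have "glue F ` ?I = w ` ?I"
      using sub card_image[OF inj'] card_image[OF inj_w, of ?I] by (intro card_subset_eq) auto
    then have "sum (glue F) ?I = sum w ?I"
      using sum.reindex[OF inj', of "\<lambda>x. x"] sum.reindex[OF inj_w, of "\<lambda>x. x" ?I]
      by simp
    then show ?thesis
      using w affine_perms_iff_displacement[OF n_pos, of w c] by (simp add: sum_subtractf)
  qed
  ultimately show "glue F \<in> affine_perms n"
    by (simp add: affine_perms_iff_displacement[OF n_pos, of _ c] bij_def)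
qed

end

section \<open>Stack-sorting by blocks\<close>

definition ltr_positions :: "(int \<Rightarrow> int) \<Rightarrow> int set" where
  "ltr_positions w = {a. \<forall>j<a. w j < w a}"

text \<open>Bounded displacement leaves finitely many positions \<open>k \<le> 0\<close> with
  \<open>w k \<ge> w 0\<close>; the one with the largest value is a left-to-right maximum.\<close>

lemma periodic_ltr_positions:
  assumes n: "n \<ge> 1" and w: "w \<in> affine_perms n"
  shows "periodic_positions n (ltr_positions w)"
proof
  obtain B where B: "\<And>i. \<bar>w i - i\<bar> \<le> B"
    using affine_perms_displacement_bounded[OF n w] by blast
  define S where "S = {k. k \<le> 0 \<and> w 0 \<le> w k}"
  have "S \<subseteq> {w 0 - B..0}"
  proof
    fix k assume "k \<in> S"
    then show "k \<in> {w 0 - B..0}" using B[of k] by (auto simp: S_def)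
  qed
  then have "finite S" by (rule finite_subset) simp
  moreover have "0 \<in> S" by (simp add: S_def)
  ultimately obtain m where m: "m \<in> S" "\<And>k. k \<in> S \<Longrightarrow> w k \<le> w m"
    using finite_argmax_exists[of S w] by blast
  have "w j < w m" if "j < m" for j
  proof (cases "j \<in> S")
    case True
    moreover have "w j \<noteq> w m" using affine_perms_eq_iff[OF w, of j m] that by simp
    ultimately show ?thesis using m(2)[of j] by simp
  qed (use m(1) that in \<open>auto simp: S_def\<close>)
  then show "ltr_positions w \<noteq> {}" by (auto simp: ltr_positions_def)
  have "(\<forall>j<a + int n. w j < w (a + int n)) \<longleftrightarrow> (\<forall>j<a. w j < w a)" for a
  proof (intro iffI allI impI)
    fix j assume "\<forall>j<a + int n. w j < w (a + int n)" "j < a"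
    then have "w (j + int n) < w (a + int n)" by simp
    then show "w j < w a" by (simp add: affine_permsD(2)[OF w])
  next
    fix j assume *: "\<forall>j<a. w j < w a" "j < a + int n"
    then have "w (j - int n) < w a" by simp
    then show "w j < w (a + int n)"
      using affine_permsD(2)[OF w, of "j - int n"] affine_permsD(2)[OF w, of a] by simp
  qed
  then show "periodic_set n (ltr_positions w)"
    by (simp add: periodic_set_def ltr_positions_def)
qed (fact n)

context periodic_positions
begin

text \<open>The candidate for the minimal element sends a position of \<open>w\<close> to the
  position of the same value in \<open>v\<close>. Inside a block the finite map determines its
  inversions; it maps each block to itself, so no inversion crosses a boundary.\<close>

lemma affine_stack_sort_eqI:
  assumes w: "w \<in> affine_perms n" and A: "A = ltr_positions w"
    and blk: "\<And>a. a \<in> A \<Longrightarrow> map v [a..nxt a - 1] = stack_sort (map w [a..nxt a - 1])"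
    and v: "v \<in> affine_perms n"
  shows "affine_stack_sort n w = v"
proof -
  have inj_w: "inj_on w S" for S
    by (rule inj_onI) (simp add: affine_perms_eq_iff[OF w])
  have img: "v ` {a..<nxt a} = w ` {a..<nxt a}" if "a \<in> A" for a
  proof -
    have "{a..nxt a - 1} = {a..<nxt a}" by auto
    then show ?thesis
      using arg_cong[OF blk[OF that], of set] set_stack_sort[of "map w [a..nxt a - 1]"] inj_w
      by (simp add: distinct_map)
  qed
  define u where "u = inv v \<circ> w"
  have u: "u \<in> affine_perms n"
    unfolding u_def using n_pos w v affine_perms_comp affine_perms_inv by blast
  have vu: "v (u i) = w i" for i by (simp add: u_def affine_perms_inv_apply[OF v])
  have u_block: "u i \<in> {prv i..<nxt (prv i)}" for i
  proof -
    have "w i \<in> v ` {prv i..<nxt (prv i)}"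
      using img[OF prv_props(1)] prv_props(2)[of i] less_nxt_prv[of i] by auto
    then show ?thesis using vu[of i] affine_perms_eq_iff[OF v] by (metis imageE)
  qed
  have "u j < u i \<longleftrightarrow> (\<forall>k\<in>{i<..j}. w k < w i)" if "i < j" for i j
  proof (cases "prv i = prv j")
    case True
    let ?a = "prv i" and ?b = "nxt (prv i)"
    show ?thesis
    proof (rule stack_sort_interval_order[where a = ?a and b = ?b and c = ?a and v = v])
      show "map v [?a..?a + (?b - ?a) - 1] = stack_sort (map w [?a..?b - 1])"
        using blk[OF prv_props(1)] by simp
    qed (use that u_block[of i] u_block[of j] True prv_props(2)[of i] less_nxt_prv[of j] in
        \<open>auto simp: inj_w vu prv_props\<close>)
  next
    case False
    \<comment> \<open>In distinct blocks, the head \<open>prv j\<close> lies in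
      \<open>{i<..j}\<close> and, as a left-to-right maximum, has a value above \<open>w i\<close>;
      so \<open>j\<close> is no right descendant of \<open>i\<close>.\<close>
    have "prv i \<le> prv j" using le_prv[OF prv_props(1), of i j] prv_props(2)[of i] that by linarith
    then have "nxt (prv i) \<le> prv j" using nxt_le[OF prv_props(1)] False by simp
    then have "u i < u j" "i < prv j" using u_block[of i] u_block[of j] less_nxt_prv[of i] by auto
    moreover have "w i < w (prv j)"
      using prv_props(1)[of j] \<open>i < prv j\<close> by (simp add: A ltr_positions_def)
    moreover have "prv j \<in> {i<..j}" using \<open>i < prv j\<close> prv_props(2)[of j] by simp
    ultimately show ?thesis by (meson less_asym)
  qed
  then have "inversions u = right_descendants w"
    by (auto simp: inversions_def right_descendants_def)
  then have "pi_down n w = u" by (rule pi_down_eqI[OF n_pos w u])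
  moreover have "w (inv u x) = v x" for x
    by (metis vu affine_perms_inv_apply(1)[OF u])
  ultimately show ?thesis by (auto simp: affine_stack_sort_def)
qed

text \<open>The forward direction needs an affine permutation with the sorted blocks to exist:
  gluing gives one, and it coincides with \<open>v\<close> since both are the image of
  \<open>w\<close>.\<close>

lemma affine_stack_sort_iff:
  assumes w: "w \<in> affine_perms n" and A: "A = ltr_positions w" and v: "v \<in> affine_perms n"
  shows "affine_stack_sort n w = v \<longleftrightarrow>
    (\<forall>a\<in>A. map v [a..nxt a - 1] = stack_sort (map w [a..nxt a - 1]))"
proof
  assume sorted: "affine_stack_sort n w = v"
  define F where "F a = stack_sort (map w [a..nxt a - 1])" for a
  have dist: "distinct (map w [a..nxt a - 1])" for a
    by (simp add: distinct_map inj_on_def affine_perms_eq_iff[OF w])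
  have set: "set (F a) = w ` {a..<nxt a}" for a
  proof -
    have "{a..nxt a - 1} = {a..<nxt a}" by auto
    then show ?thesis by (simp add: F_def set_stack_sort[OF dist])
  qed
  have per: "F (a + int n) = map (\<lambda>x. x + int n) (F a)" for a
  proof -
    have "map w [a + int n..nxt (a + int n) - 1] =
        map (\<lambda>x. x + int n) (map w [a..nxt a - 1])"
      using map_upto_shift[OF w, of a 1 "nxt a - 1"] nxt_shift[of a 1] by (simp add: algebra_simps)
    then show ?thesis unfolding F_def by (simp only: stack_sort_map_add[OF dist])
  qed
  have "distinct (F a)" for a unfolding F_def by (rule distinct_stack_sort[OF dist])
  note glue = glue_affine_perms[OF w this set per] map_glue_rearrangement[OF w this set per]
  have "affine_stack_sort n w = glue F"
    using glue by (intro affine_stack_sort_eqI[OF w A]) (auto simp flip: F_def)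
  then show "\<forall>a\<in>A. map v [a..nxt a - 1] = stack_sort (map w [a..nxt a - 1])"
    using glue(2) sorted by (simp flip: F_def)
qed (use affine_stack_sort_eqI[OF w A _ v] in blast)

end

section \<open>Preimages with prescribed block starts\<close>

definition sorting_fiber :: "nat \<Rightarrow> int set \<Rightarrow> (int \<Rightarrow> int) \<Rightarrow> (int \<Rightarrow> int) set" where
  "sorting_fiber n A v = {w \<in> affine_perms n. ltr_positions w = A \<and> affine_stack_sort n w = v}"

context periodic_positions
begin

text \<open>The position of the maximum over a block is itself a left-to-right maximum, hence in
  \<open>A\<close>, and a block meets \<open>A\<close> only in its start.\<close>

lemma less_block_head:
  assumes w: "w \<in> affine_perms n" and A: "A = ltr_positions w"
    and a: "a \<in> A" and k: "k < nxt a" "k \<noteq> a"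
  shows "w k < w a"
proof (cases "k < a")
  case True
  then show ?thesis using a by (simp add: A ltr_positions_def)
next
  case False
  obtain m where m: "m \<in> {a..<nxt a}" "\<And>k. k \<in> {a..<nxt a} \<Longrightarrow> w k \<le> w m"
    using finite_argmax_exists[of "{a..<nxt a}" w] nxt_props(2)[of a] by auto
  have "w j < w m" if "j < m" for j
  proof (cases "j < a")
    case True
    then have "w j < w a" using a by (simp add: A ltr_positions_def)
    also have "w a \<le> w m" using m(2)[of a] nxt_props(2)[of a] by simp
    finally show ?thesis .
  next
    case False
    then have "w j \<le> w m" using that m(1) by (intro m(2)) auto
    then show ?thesis using that affine_perms_eq_iff[OF w, of j m] by simp
  qed
  then have "m \<in> A" by (simp add: A ltr_positions_def)
  then have "m = a" using nxt_le[of m a] m(1) by force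
  then have "w k \<le> w a" using m(2)[of k] k False by simp
  then show ?thesis using k affine_perms_eq_iff[OF w, of k a] by simp
qed

lemma upto_block: "[a..nxt a - 1] = a # [a + 1..nxt a - 1]" "[a..nxt a - 1] = [a..nxt a - 2] @ [nxt a - 1]"
  using nxt_props(2)[of a] upto_rec1[of a "nxt a - 1"] upto_rec2[of a "nxt a - 1"] by simp_all

text \<open>Compares the last letter of \<open>s(R) m\<close> with that of the block of
  \<open>v\<close>. The maximum takes the place \<open>nxt a - 1\<close>, so the sorted tail ends at
  \<open>nxt a - 2\<close>; for a block of length 1 it is empty.\<close>

lemma sorting_fiber_block:
  assumes v: "v \<in> affine_perms n" and wv: "w \<in> sorting_fiber n A v" and a: "a \<in> A"
  shows "w a = v (nxt a - 1)" and "stack_sort (map w [a + 1..nxt a - 1]) = map v [a..nxt a - 2]"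
proof -
  from wv have w: "w \<in> affine_perms n" and A: "A = ltr_positions w"
    and "affine_stack_sort n w = v" by (auto simp: sorting_fiber_def)
  then have "map v [a..nxt a - 1] = stack_sort (map w [a..nxt a - 1])"
    using affine_stack_sort_iff[OF w A v] a by blast
  also have "\<dots> = stack_sort (map w [a + 1..nxt a - 1]) @ [w a]"
    using less_block_head[OF w A a]
    by (simp only: upto_block(1)[of a] list.map) (rule stack_sort_Cons_max, auto)
  finally have "map v [a..nxt a - 2] @ [v (nxt a - 1)] = stack_sort (map w [a + 1..nxt a - 1]) @ [w a]"
    by (simp add: upto_block(2)[of a])
  then show "w a = v (nxt a - 1)" "stack_sort (map w [a + 1..nxt a - 1]) = map v [a..nxt a - 2]"
    by simp_all
qed

text \<open>The tails over one period are the free data of a preimage: heads are dictated by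
  \<open>v\<close>, other periods by translation. \<open>restrict\<close> puts the data into the
  extensional product \<open>PiE\<close>.\<close>

definition tails :: "int \<Rightarrow> (int \<Rightarrow> int) \<Rightarrow> int \<Rightarrow> int list" where
  "tails c w = restrict (\<lambda>a. map w [a + 1..nxt a - 1]) (A \<inter> {c..<c + int n})"

lemma tails_mem:
  assumes v: "v \<in> affine_perms n" and wv: "w \<in> sorting_fiber n A v"
  shows "tails c w \<in> PiE (A \<inter> {c..<c + int n}) (\<lambda>a. stack_sort_preimage (map v [a..nxt a - 2]))"
proof -
  from wv have w: "w \<in> affine_perms n" by (simp add: sorting_fiber_def)
  show ?thesis
    using sorting_fiber_block(2)[OF v wv]
    by (auto simp: tails_def stack_sort_preimage_def distinct_map inj_on_def affine_perms_eq_iff[OF w])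
qed

lemma mod_window: "c + (i - c) mod int n \<in> {c..<c + int n}"
  using n_pos by simp

lemma mod_window_shift: "i = c + (i - c) mod int n + int n * ((i - c) div int n)"
  by simp

lemma inj_on_tails:
  assumes v: "v \<in> affine_perms n" and c: "c \<in> A"
  shows "inj_on (tails c) (sorting_fiber n A v)"
proof (rule inj_onI)
  fix w w' assume ww': "w \<in> sorting_fiber n A v" "w' \<in> sorting_fiber n A v"
    and eq: "tails c w = tails c w'"
  then have aff: "w \<in> affine_perms n" "w' \<in> affine_perms n" by (auto simp: sorting_fiber_def)
  have window: "w i = w' i" if i: "i \<in> {c..<c + int n}" for i
  proof -
    let ?a = "prv i"
    have a: "?a \<in> A" "?a \<in> {c..<c + int n}"
      using prv_props[of i] le_prv[OF c] i by auto
    have "map w [?a + 1..nxt ?a - 1] = map w' [?a + 1..nxt ?a - 1]"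
      using fun_cong[OF eq, of ?a] a by (simp add: tails_def)
    moreover have "w ?a = w' ?a"
      using sorting_fiber_block(1)[OF v ww'(1) a(1)] sorting_fiber_block(1)[OF v ww'(2) a(1)] by simp
    ultimately have "map w [?a..nxt ?a - 1] = map w' [?a..nxt ?a - 1]"
      unfolding upto_block(1)[of ?a] by simp
    moreover have "i \<in> set [?a..nxt ?a - 1]" using prv_props(2)[of i] less_nxt_prv[of i] by simp
    ultimately show ?thesis by (metis map_eq_conv)
  qed
  show "w = w'"
  proof
    fix i
    show "w i = w' i"
      by (subst (1 2) mod_window_shift[of i c])
        (simp only: affine_perms_shift[OF aff(1)] affine_perms_shift[OF aff(2)] window[OF mod_window])
  qed
qed

text \<open>The assumption on \<open>v\<close> makes each block end the largest value so far. Moved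
  to the front of its block, it becomes a left-to-right maximum of \<open>w\<close>, and it keeps
  the other positions of the block from being one.\<close>

lemma tails_surj:
  assumes v: "v \<in> affine_perms n" and c: "c \<in> A"
    and max: "\<And>b. b \<in> A \<Longrightarrow> b - 1 \<in> ltr_positions v"
    and R: "R \<in> PiE (A \<inter> {c..<c + int n}) (\<lambda>a. stack_sort_preimage (map v [a..nxt a - 2]))"
  shows "\<exists>w\<in>sorting_fiber n A v. tails c w = R"
proof -
  \<comment> \<open>\<open>base a\<close> is the translate of \<open>a\<close> in the window and
    \<open>off a\<close> the number of periods between them; they extend \<open>R\<close> from one
    period to all of \<open>A\<close>.\<close>
  define base where "base a = c + (a - c) mod int n" for a
  define off where "off a = (a - c) div int n" for a
  have a_eq: "a = base a + int n * off a" for a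
    unfolding base_def off_def by (rule mod_window_shift)
  have base: "base a \<in> A \<inter> {c..<c + int n}" if "a \<in> A" for a
    using mod_window[of c a] that shift_mem[of "base a" "off a"] a_eq[of a] by (simp add: base_def)
  define S where "S a = map (\<lambda>x. x + int n * off a) (R (base a))" for a
  have S: "stack_sort (S a) = map v [a..nxt a - 2]" "distinct (S a)" if "a \<in> A" for a
  proof -
    have Ra: "stack_sort (R (base a)) = map v [base a..nxt (base a) - 2]" "distinct (R (base a))"
      using PiE_mem[OF R base[OF that]] by (auto simp: stack_sort_preimage_def)
    have "stack_sort (S a) = map v [base a + int n * off a..nxt (base a) - 2 + int n * off a]"
      unfolding S_def stack_sort_map_add[OF Ra(2)] Ra(1) map_upto_shift[OF v] ..
    also have "nxt (base a) - 2 + int n * off a = nxt a - 2"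
      using nxt_shift[of "base a" "off a"] a_eq[of a] by simp
    finally show "stack_sort (S a) = map v [a..nxt a - 2]" by (simp flip: a_eq)
    show "distinct (S a)" using Ra(2) by (simp add: S_def distinct_map)
  qed
  have set_S: "set (S a) = v ` {a..nxt a - 2}" if "a \<in> A" for a
    using set_stack_sort[OF S(2)[OF that]] S(1)[OF that] by simp
  define F where "F a = v (nxt a - 1) # S a" for a
  have block: "{a..<nxt a} = insert (nxt a - 1) {a..nxt a - 2}" for a
    using nxt_props(2)[of a] by auto
  have dist: "distinct (F a)" if "a \<in> A" for a
    using S(2)[OF that] set_S[OF that] by (auto simp: F_def affine_perms_eq_iff[OF v])
  have set_F: "set (F a) = v ` {a..<nxt a}" if "a \<in> A" for a
    unfolding block using set_S[OF that] by (simp add: F_def)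
  have per: "F (a + int n) = map (\<lambda>x. x + int n) (F a)" for a
  proof -
    have "base (a + int n) = base a" "off (a + int n) = off a + 1"
      using n_pos by (simp_all add: base_def off_def diff_add_eq[symmetric] div_add_self2)
    moreover have "v (nxt (a + int n) - 1) = v (nxt a - 1) + int n"
      using nxt_shift[of a 1] affine_permsD(2)[OF v, of "nxt a - 1"] by (simp add: algebra_simps)
    ultimately show ?thesis by (simp add: F_def S_def algebra_simps)
  qed
  define w where "w = glue F"
  have w: "w \<in> affine_perms n" and wF: "\<And>a. a \<in> A \<Longrightarrow> map w [a..nxt a - 1] = F a"
    unfolding w_def by (rule glue_affine_perms[OF v dist set_F per] map_glue_rearrangement[OF v dist set_F per]; assumption)+
  have w_parts: "w a = v (nxt a - 1)" "map w [a + 1..nxt a - 1] = S a" if "a \<in> A" for a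
    using wF[OF that] by (simp_all add: upto_block(1)[of a] F_def)
  have w_img: "\<exists>k\<in>{prv j..<nxt (prv j)}. w j = v k" for j
  proof -
    have "j \<in> set [prv j..nxt (prv j) - 1]" using prv_props(2)[of j] less_nxt_prv[of j] by simp
    then have "w j \<in> set (map w [prv j..nxt (prv j) - 1])" by simp
    then show ?thesis unfolding wF[OF prv_props(1)] set_F[OF prv_props(1)] by blast
  qed
  have max': "v k < v (b - 1)" if "b \<in> A" "k < b - 1" for b k
    using max[OF that(1)] that(2) by (simp add: ltr_positions_def)
  have "ltr_positions w = A"
  proof (intro equalityI subsetI)
    fix a assume a: "a \<in> A"
    have "w j < w a" if "j < a" for j
    proof -
      obtain k where k: "k < nxt (prv j)" "w j = v k" using w_img[of j] by auto
      have "nxt (prv j) \<le> a" using nxt_le[OF a, of "prv j"] prv_props(2)[of j] that by simp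
      then have "k < nxt a - 1" using k(1) nxt_props(2)[of a] by simp
      then show ?thesis using max'[OF nxt_props(1)] k(2) w_parts(1)[OF a] by simp
    qed
    then show "a \<in> ltr_positions w" by (simp add: ltr_positions_def)
  next
    fix i assume i: "i \<in> ltr_positions w"
    show "i \<in> A"
    proof (rule ccontr)
      assume "i \<notin> A"
      then have "prv i < i" using prv_props[of i] by (metis order_le_less)
      then have "w (prv i) < w i" using i by (simp add: ltr_positions_def)
      moreover obtain k where k: "k < nxt (prv i)" "w i = v k" using w_img[of i] by auto
      moreover have "v k \<le> v (nxt (prv i) - 1)"
        using max'[OF nxt_props(1)[of "prv i"], of k] k(1) by (cases "k = nxt (prv i) - 1") auto
      ultimately show False using w_parts(1)[OF prv_props(1)[of i]] by simp
    qed
  qed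
  moreover have "affine_stack_sort n w = v"
  proof (rule affine_stack_sort_eqI[OF w _ _ v])
    show "A = ltr_positions w" using \<open>ltr_positions w = A\<close> ..
    fix a assume a: "a \<in> A"
    have "stack_sort (F a) = stack_sort (S a) @ [v (nxt a - 1)]"
      unfolding F_def using set_S[OF a] max'[OF nxt_props(1)] by (intro stack_sort_Cons_max) auto
    moreover have "map v [a..nxt a - 1] = map v [a..nxt a - 2] @ [v (nxt a - 1)]"
      by (simp add: upto_block(2)[of a])
    ultimately show "map v [a..nxt a - 1] = stack_sort (map w [a..nxt a - 1])"
      by (simp add: wF[OF a] S(1)[OF a])
  qed
  moreover have "tails c w = R"
  proof (rule extensionalityI[of _ "A \<inter> {c..<c + int n}"])
    fix a assume a: "a \<in> A \<inter> {c..<c + int n}"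
    then have "(a - c) mod int n = a - c" "(a - c) div int n = 0" by auto
    then have "S a = R a" by (simp add: S_def base_def off_def)
    then show "tails c w a = R a" using a w_parts(2) by (simp add: tails_def)
  qed (use R in \<open>auto simp: tails_def PiE_def\<close>)
  ultimately show ?thesis using w by (auto simp: sorting_fiber_def)
qed

lemma card_sorting_fiber:
  assumes v: "v \<in> affine_perms n" and c: "c \<in> A"
    and max: "\<And>b. b \<in> A \<Longrightarrow> b - 1 \<in> ltr_positions v"
  shows "finite (sorting_fiber n A v)"
    and "card (sorting_fiber n A v) =
      (\<Prod>a\<in>A \<inter> {c..<c + int n}. card (stack_sort_preimage (map v [a..nxt a - 2])))"
proof -
  let ?W = "A \<inter> {c..<c + int n}"
  have bij: "bij_betw (tails c) (sorting_fiber n A v)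
      (PiE ?W (\<lambda>a. stack_sort_preimage (map v [a..nxt a - 2])))"
    unfolding bij_betw_def
    using inj_on_tails[OF v c] tails_mem[OF v] tails_surj[OF v c max] by (auto simp: image_iff) metis
  have "finite (PiE ?W (\<lambda>a. stack_sort_preimage (map v [a..nxt a - 2])))"
    by (intro finite_PiE finite_stack_sort_preimage) simp
  then show "finite (sorting_fiber n A v)" using bij bij_betw_finite by blast
  show "card (sorting_fiber n A v) =
      (\<Prod>a\<in>?W. card (stack_sort_preimage (map v [a..nxt a - 2])))"
    using bij_betw_same_card[OF bij] by (simp add: card_PiE)
qed

section \<open>Increasing enumerations of periodic sets\<close>

lemma enumeration_exists:
  assumes c: "c \<in> A"
  obtains e :: "int \<Rightarrow> int" and r :: int
  where "strict_mono e" "range e = A" "e 1 = c" "r > 0" "\<And>j. e (j + r) = e j + int n"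
proof -
  define xs where "xs = sorted_list_of_set (A \<inter> {c..<c + int n})"
  have set_xs: "set xs = A \<inter> {c..<c + int n}" and sorted: "sorted_wrt (<) xs"
    by (simp_all add: xs_def)
  define r where "r = int (length xs)"
  have "c \<in> set xs" using c n_pos by (simp add: set_xs)
  then have r: "r > 0" by (auto simp: r_def)
  \<comment> \<open>The sorted elements of one window, repeated with period \<open>r\<close>; using
    \<open>k - 1\<close> puts \<open>c\<close> at index 1, where the product over skyline blocks
    starts.\<close>
  define e where "e k = xs ! nat ((k - 1) mod r) + int n * ((k - 1) div r)" for k
  have in_window: "xs ! nat t \<in> A \<inter> {c..<c + int n}" if "0 \<le> t" "t < r" for t
    using that nth_mem[of "nat t" xs] by (simp add: set_xs r_def)
  have step: "e k < e (k + 1)" for k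
  proof -
    define q t where "q = (k - 1) div r" and "t = (k - 1) mod r"
    have t: "0 \<le> t" "t < r" using r by (simp_all add: t_def)
    have k: "k = t + 1 + q * r" by (simp add: q_def t_def)
    have ek: "e k = xs ! nat t + int n * q" by (simp add: e_def q_def t_def)
    show ?thesis
    proof (cases "t + 1 < r")
      case True
      then have "k div r = q" "k mod r = t + 1" using t by (simp_all add: k)
      then have "e (k + 1) = xs ! nat (t + 1) + int n * q" by (simp add: e_def)
      moreover have "xs ! nat t < xs ! nat (t + 1)"
        using sorted_wrt_nth_less[OF sorted, of "nat t" "nat (t + 1)"] True t by (simp add: r_def)
      ultimately show ?thesis by (simp add: ek)
    next
      case False
      then have "k = (q + 1) * r" using t k by (simp add: algebra_simps)
      then have "k div r = q + 1" "k mod r = 0" using r by simp_all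
      then have "e (k + 1) = xs ! nat 0 + int n * (q + 1)" by (simp add: e_def)
      moreover have "xs ! nat t < xs ! nat 0 + int n"
        using in_window[of t] in_window[of 0] t r by simp
      ultimately show ?thesis by (simp add: ek algebra_simps)
    qed
  qed
  show thesis
  proof
    show "strict_mono e" using step by (rule strict_mono_int_if_step)
    show "r > 0" by (fact r)
    show "e (j + r) = e j + int n" for j
    proof -
      have "(j + r - 1) mod r = (j - 1) mod r" "(j + r - 1) div r = (j - 1) div r + 1"
        using r by (simp_all add: diff_add_eq[symmetric] div_add_self2)
      then show ?thesis by (simp add: e_def algebra_simps)
    qed
    show "range e = A"
    proof (intro equalityI subsetI)
      fix a assume "a \<in> range e"
      then obtain k where "a = e k" by blast
      then show "a \<in> A" using in_window[of "(k - 1) mod r"] r by (simp add: e_def shift_mem)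
    next
      fix a assume "a \<in> A"
      define b q where "b = c + (a - c) mod int n" and "q = (a - c) div int n"
      have a: "a = b + int n * q" unfolding b_def q_def by (rule mod_window_shift)
      have "b \<in> A" using \<open>a \<in> A\<close> shift_mem[of b q] by (simp add: a[symmetric])
      then have "b \<in> set xs" using mod_window[of c a] by (simp add: set_xs b_def)
      then obtain t where t: "t < length xs" "xs ! t = b" by (auto simp: in_set_conv_nth)
      have "(int t + r * q) div r = q" "(int t + r * q) mod r = int t"
        using t(1) r by (simp_all add: r_def)
      then have "e (int t + r * q + 1) = a" using a t(2) by (simp add: e_def)
      then show "a \<in> range e" by blast
    qed
    obtain t where t: "t < length xs" "xs ! t = c" using \<open>c \<in> set xs\<close> by (auto simp: in_set_conv_nth)
    then have "xs ! 0 \<le> c" using sorted_wrt_nth_less[OF sorted, of 0 t] by (cases "t = 0") auto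
    then show "e 1 = c" using in_window[of 0] r by (simp add: e_def)
  qed
qed

end

text \<open>\<open>inv e \<circ> e'\<close> is an increasing surjection of the integers, hence a
  translation. So only an index shift is left to be fixed in a skyline enumeration.\<close>

lemma strict_mono_same_range:
  fixes e e' :: "int \<Rightarrow> int"
  assumes e: "strict_mono e" and e': "strict_mono e'" and range: "range e = range e'"
  shows "\<exists>s. \<forall>k. e' k = e (k + s)"
proof -
  define f where "f = inv e \<circ> e'"
  have ef: "e (f k) = e' k" for k
    using range by (simp add: f_def f_inv_into_f)
  have "f k < f (k + 1)" for k
    using strict_mono_less[OF e, of "f k" "f (k + 1)"] strict_mono_less[OF e', of k "k + 1"] by (simp add: ef)
  moreover have "surj f"
  proof (rule surjI)
    fix k
    have "e' (inv e' (e k)) = e k" using range by (metis f_inv_into_f rangeI)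
    then show "f (inv e' (e k)) = k" using strict_mono_eq[OF e] by (metis ef)
  qed
  ultimately have "f k = k + f 0" for k by (rule strict_mono_bij_int_translation)
  then have "e' k = e (k + f 0)" for k using ef by metis
  then show ?thesis by blast
qed

section \<open>Skylines\<close>

text \<open>The block starts of a preimage of \<open>v\<close> with skyline \<open>M\<close>: each block of \<open>v\<close> ends in an
  element of \<open>M\<close>.\<close>

definition sky_starts :: "(int \<Rightarrow> int) \<Rightarrow> int set \<Rightarrow> int set" where
  "sky_starts v M = (\<lambda>m. inv v m + 1) ` M"

text \<open>The starts keep all information on \<open>M\<close>, whose elements are the values of
  \<open>v\<close> just before them. This separates the fibers of different skylines.\<close>

lemma
  assumes n: "n \<ge> 1" and v: "v \<in> affine_perms n" and M: "M \<in> Sky n v"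
  shows periodic_sky_starts: "periodic_positions n (sky_starts v M)"
    and sky_starts_ltr: "b \<in> sky_starts v M \<Longrightarrow> b - 1 \<in> ltr_positions v"
    and sky_starts_value: "(\<lambda>b. v (b - 1)) ` sky_starts v M = M"
proof -
  have mem: "b \<in> sky_starts v M \<longleftrightarrow> v (b - 1) \<in> M" for b
    unfolding sky_starts_def image_iff
    by (metis add_diff_cancel_right' affine_perms_inv_apply[OF v] diff_add_cancel)
  show "periodic_positions n (sky_starts v M)"
  proof
    show "sky_starts v M \<noteq> {}" using M by (simp add: sky_starts_def Sky_def)
    have "v (b + int n - 1) = v (b - 1) + int n" for b
      using affine_permsD(2)[OF v, of "b - 1"] by (simp add: algebra_simps)
    then show "periodic_set n (sky_starts v M)"
      using M by (simp add: periodic_set_def mem Sky_def)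
  qed (fact n)
  show "b - 1 \<in> ltr_positions v" if "b \<in> sky_starts v M" for b
    using that M by (auto simp: mem Sky_def ltr_maxima_def ltr_positions_def affine_perms_inv_apply[OF v])
  show "(\<lambda>b. v (b - 1)) ` sky_starts v M = M"
    by (simp add: sky_starts_def image_image affine_perms_inv_apply[OF v])
qed

text \<open>The skyline of \<open>w\<close> consists of the values of \<open>v\<close> that end its
  blocks. They are left-to-right maxima of \<open>v\<close>: sorting keeps values within their
  blocks, so every earlier value is below the head of the block of \<open>w\<close> in
  question.\<close>

lemma affine_stack_sort_preimage_eq:
  assumes n: "n \<ge> 1" and v: "v \<in> affine_perms n"
  shows "affine_stack_sort_preimage n v = (\<Union>M\<in>Sky n v. sorting_fiber n (sky_starts v M) v)"
proof (intro equalityI subsetI)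
  fix w assume "w \<in> affine_stack_sort_preimage n v"
  then have w: "w \<in> affine_perms n" and wv: "affine_stack_sort n w = v"
    by (auto simp: affine_stack_sort_preimage_def)
  define A where "A = ltr_positions w"
  interpret periodic_positions n A
    unfolding A_def by (rule periodic_ltr_positions[OF n w])
  have fiber: "w \<in> sorting_fiber n A v" by (simp add: sorting_fiber_def w wv A_def)
  have "a - 1 \<in> ltr_positions v" if a: "a \<in> A" for a
  proof -
    define h where "h = prv (a - 1)"
    have h: "h \<in> A" "nxt h = a" by (simp_all add: h_def prv_props nxt_prv_pred a)
    have wh: "w h = v (a - 1)" using sorting_fiber_block(1)[OF v fiber h(1)] h(2) by simp
    have "v j < v (a - 1)" if j: "j < a - 1" for j
    proof -
      have "map v [prv j..nxt (prv j) - 1] = stack_sort (map w [prv j..nxt (prv j) - 1])"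
        using affine_stack_sort_iff[OF w A_def v] wv prv_props(1) by blast
      then have "set (map v [prv j..nxt (prv j) - 1]) = set (map w [prv j..nxt (prv j) - 1])"
        by (simp add: set_stack_sort distinct_map inj_on_def affine_perms_eq_iff[OF w])
      then have "v j \<in> w ` {prv j..nxt (prv j) - 1}"
        using prv_props(2)[of j] less_nxt_prv[of j] by auto
      then obtain k where k: "k < nxt (prv j)" "v j = w k" by auto
      have "nxt (prv j) \<le> a" using nxt_le[OF a, of "prv j"] prv_props(2)[of j] j by simp
      moreover have "k \<noteq> h" using k(2) wh affine_perms_eq_iff[OF v, of j "a - 1"] j by auto
      ultimately show ?thesis
        using less_block_head[OF w A_def h(1), of k] k h(2) wh by simp
    qed
    then show ?thesis by (simp add: ltr_positions_def)
  qed
  define M where "M = (\<lambda>a. v (a - 1)) ` A"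
  have "M \<subseteq> ltr_maxima v"
    using \<open>\<And>a. a \<in> A \<Longrightarrow> a - 1 \<in> ltr_positions v\<close>
    by (auto simp: M_def ltr_maxima_def ltr_positions_def affine_perms_inv_apply[OF v])
  moreover have "periodic_set n M"
    unfolding periodic_set_def
  proof (intro allI)
    fix m
    have mem: "m \<in> M \<longleftrightarrow> inv v m + 1 \<in> A" for m
      unfolding M_def image_iff
      by (metis add_diff_cancel_right' affine_perms_inv_apply[OF v] diff_add_cancel)
    have "inv v (m + int n) + 1 = inv v m + 1 + int n"
      using affine_permsD(2)[OF affine_perms_inv[OF n v]] by simp
    then show "m \<in> M \<longleftrightarrow> m + int n \<in> M"
      using shift_mem[of "inv v m + 1" 1] by (simp add: mem ac_simps)
  qed
  ultimately have "M \<in> Sky n v" using nonempty by (simp add: Sky_def M_def)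
  moreover have "sky_starts v M = A"
    by (simp add: sky_starts_def M_def image_image affine_perms_inv_apply[OF v])
  ultimately show "w \<in> (\<Union>M\<in>Sky n v. sorting_fiber n (sky_starts v M) v)" using fiber by auto
qed (auto simp: sorting_fiber_def affine_stack_sort_preimage_def)

lemma finite_Sky:
  assumes n: "n \<ge> 1" shows "finite (Sky n v)"
proof (rule finite_imageD)
  show "finite ((\<lambda>M. M \<inter> {0..<int n}) ` Sky n v)"
    by (rule finite_subset[of _ "Pow {0..<int n}"]) auto
  show "inj_on (\<lambda>M. M \<inter> {0..<int n}) (Sky n v)"
  proof (rule inj_onI)
    fix M M' assume M: "M \<in> Sky n v" "M' \<in> Sky n v" "M \<inter> {0..<int n} = M' \<inter> {0..<int n}"
    have "m \<in> K \<longleftrightarrow> m mod int n \<in> K \<inter> {0..<int n}" if "K \<in> Sky n v" for K m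
    proof -
      interpret periodic_positions n K using that n by unfold_locales (auto simp: Sky_def)
      show ?thesis using shift_mem[of "m mod int n" "m div int n"] n by simp
    qed
    then show "M = M'" using M by blast
  qed
qed

text \<open>Resolves the \<open>THE\<close> definitions of the skyline indexing and passes to a
  window of block starts, the form in which fibers are counted.\<close>

lemma sky_product_eq_window:
  assumes n: "n \<ge> 1" and v: "v \<in> affine_perms n" and M: "M \<in> Sky n v"
  shows "\<exists>c\<in>sky_starts v M.
    (\<Prod>i=1..sky_period n v M. f (sky_word v M i)) =
    (\<Prod>a\<in>sky_starts v M \<inter> {c..<c + int n}.
      f (map v [a..periodic_positions.nxt n (sky_starts v M) a - 2]) :: nat)"
proof -
  define A where "A = sky_starts v M"
  interpret periodic_positions n A
    unfolding A_def by (rule periodic_sky_starts[OF assms])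
  \<comment> \<open>Starts lie one place after skyline positions, so the normalisation
    \<open>inv v (m 1) \<le> 1 < inv v (m 2)\<close> says that the start with index 1 is at most 2
    and the next one exceeds 2.\<close>
  define c where "c = prv 2"
  have c: "c \<in> A" "c \<le> 2" "2 < nxt c" using prv_props[of 2] less_nxt_prv[of 2] by (simp_all add: c_def)
  obtain p :: "int \<Rightarrow> int" and r :: int where p: "strict_mono p" "range p = A" "p 1 = c" "r > 0"
    and per: "\<And>j. p (j + r) = p j + int n" by (rule enumeration_exists[OF c(1)]) (rule that)
  have p_mem: "p i \<in> A" for i using p(2) by blast
  have nxt_p: "nxt (p i) = p (i + 1)" for i
  proof (rule nxt_eqI)
    fix a assume a: "a \<in> A" "p i < a"
    then obtain j where "a = p j" using p(2) by blast
    then show "p (i + 1) \<le> a" using a(2) by (simp add: strict_mono_less[OF p(1)] strict_mono_less_eq[OF p(1)])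
  qed (simp_all add: p_mem strict_mono_less[OF p(1)])
  define e where "e i = v (p i - 1)" for i
  have inv_e: "inv v (e i) = p i - 1" for i by (simp add: e_def affine_perms_inv_apply[OF v])
  have e_mono: "strict_mono e"
  proof (rule strict_mono_int_if_step)
    fix k
    have "p (k + 1) - 1 \<in> ltr_positions v"
      using sky_starts_ltr[OF assms] p_mem[of "k + 1"] by (simp add: A_def)
    moreover have "p k - 1 < p (k + 1) - 1" by (simp add: strict_mono_less[OF p(1)])
    ultimately show "e k < e (k + 1)" by (simp add: e_def ltr_positions_def)
  qed
  have "(\<lambda>b. v (b - 1)) ` range p = M"
    unfolding p(2) A_def by (rule sky_starts_value[OF assms])
  then have e_range: "range e = M" by (simp add: e_def image_image)
  have "p 2 = nxt c" using nxt_p[of 1] p(3) by simp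
  then have norm: "inv v (e 1) \<le> 1" "1 < inv v (e 2)" using p(3) c by (simp_all add: inv_e)
  have enum: "sky_enum v M = e"
    unfolding sky_enum_def
  proof (rule the_equality)
    fix e' :: "int \<Rightarrow> int" assume e': "strict_mono e' \<and> range e' = M \<and> inv v (e' 1) \<le> 1 \<and> 1 < inv v (e' 2)"
    then obtain s :: int where s: "\<And>k. e' k = e (k + s)"
      using strict_mono_same_range[OF e_mono, of e'] e_range by blast
    \<comment> \<open>Both enumerations obey the normalisation at position 1; comparing them
      crosswise gives \<open>s < 1\<close> and \<open>s > -1\<close>.\<close>
    have "p (1 + s) < p 2" "p 1 < p (2 + s)"
      using e' norm unfolding s inv_e by linarith+
    then have "s = 0" by (simp add: strict_mono_less[OF p(1)])
    then show "e' = e" by (simp add: s fun_eq_iff)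
  qed (simp add: e_mono e_range norm)
  have e_per: "e (j + r) = e j + int n" for j
    using affine_permsD(2)[OF v, of "p j - 1"] by (simp add: e_def per algebra_simps)
  have period: "sky_period n v M = r"
    unfolding sky_period_def enum
  proof (rule the_equality)
    fix r' :: int assume "0 < r' \<and> (\<forall>j. e (j + r') = e j + int n)"
    then have "e (0 + r') = e (0 + r)" using e_per by metis
    then show "r' = r" by (simp add: strict_mono_eq[OF e_mono])
  qed (simp add: p(4) e_per)
  have word: "sky_word v M i = map v [p i..nxt (p i) - 2]" for i
    by (simp add: sky_word_def enum inv_e nxt_p)
  have "p i \<in> {c..<c + int n} \<longleftrightarrow> i \<in> {1..r}" for i
    using per[of 1] strict_mono_less_eq[OF p(1), of 1 i] strict_mono_less[OF p(1), of i "1 + r"]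
    by (auto simp: p(3))
  then have window: "A \<inter> {c..<c + int n} = p ` {1..r}"
    unfolding p(2)[symmetric] by blast
  have "inj_on p {1..r}" using strict_mono_imp_inj_on[OF p(1)] inj_on_subset by blast
  then have "(\<Prod>a\<in>A \<inter> {c..<c + int n}. f (map v [a..nxt a - 2])) =
      (\<Prod>i=1..r. f (sky_word v M i))"
    unfolding window by (simp add: prod.reindex word)
  then show ?thesis
    unfolding A_def[symmetric] period by (intro bexI[of _ c]) (simp_all add: c)
qed

theorem theorem8p11:
  fixes n :: nat and v :: "int \<Rightarrow> int"
  assumes "n \<ge> 1" and "v \<in> affine_perms n"
  shows "finite (affine_stack_sort_preimage n v) \<and>
    card (affine_stack_sort_preimage n v) =
      (\<Sum>M\<in>Sky n v. \<Prod>i=1..sky_period n v M. card (stack_sort_preimage (sky_word v M i)))"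
proof -
  let ?fiber = "\<lambda>M. sorting_fiber n (sky_starts v M) v"
  have fiber: "finite (?fiber M) \<and> card (?fiber M) =
      (\<Prod>i=1..sky_period n v M. card (stack_sort_preimage (sky_word v M i)))"
    if M: "M \<in> Sky n v" for M
  proof -
    interpret periodic_positions n "sky_starts v M" by (rule periodic_sky_starts[OF assms M])
    obtain c where c: "c \<in> sky_starts v M"
      "(\<Prod>i=1..sky_period n v M. card (stack_sort_preimage (sky_word v M i))) =
       (\<Prod>a\<in>sky_starts v M \<inter> {c..<c + int n}. card (stack_sort_preimage (map v [a..nxt a - 2])))"
      using sky_product_eq_window[OF assms M, of "\<lambda>z. card (stack_sort_preimage z)"] by (elim bexE)
    show ?thesis
      using card_sorting_fiber[OF assms(2) c(1)] sky_starts_ltr[OF assms M] c(2) by simp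
  qed
  have disjoint: "?fiber M \<inter> ?fiber M' = {}" if "M \<in> Sky n v" "M' \<in> Sky n v" "M \<noteq> M'" for M M'
  proof (rule ccontr)
    assume "?fiber M \<inter> ?fiber M' \<noteq> {}"
    then have "sky_starts v M = sky_starts v M'" by (auto simp: sorting_fiber_def)
    then show False using sky_starts_value[OF assms] that by metis
  qed
  \<comment> \<open>Finiteness is established on its own because \<open>card\<close> of an infinite
    set is 0, so the equation alone would not certify a genuine count.\<close>
  have "finite (affine_stack_sort_preimage n v)"
    unfolding affine_stack_sort_preimage_eq[OF assms] using fiber finite_Sky[OF assms(1)] by blast
  moreover have "card (affine_stack_sort_preimage n v) = (\<Sum>M\<in>Sky n v. card (?fiber M))"
    unfolding affine_stack_sort_preimage_eq[OF assms]
    using fiber disjoint finite_Sky[OF assms(1)] by (intro card_UN_disjoint) auto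
  ultimately show ?thesis using fiber by simp
qed

end
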